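(* Let $C = \Phi_{60}$ be the $60$-th cyclotomic polynomial and let $L$ be an even unimodular lattice of signature $(3,19)$. The lattice $L$ does not have any isometry $t : L \to L$ having both of the following properties: (i) The characteristic polynomial of $t$ is $CC'$, where $C'$ is a product of cyclotomic polynomials. (ii) The signature of the sublattice $L_C = \mathrm{Ker}(C(t))$ of $L$ is $(2,14)$.
   Context: A lattice is a pair $(L,q)$, where $L$ is a free $\mathbf{Z}$-module of finite rank and $q : L\times L\to\mathbf{Z}$ is a symmetric bilinear form; it is unimodular if $\det(q)=\pm1$, and even if $q(x,x)$ is even for all $x\in L$. An isometry of $L$ is an automorphism of the $\mathbf{Z}$-module $L$ preserving $q$. Cyclotomic polynomials include $\Phi_1 = x-1$ and $\Phi_2 = x+1$, and products may have repeated factors. *)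

theory Defs
  imports "Jordan_Normal_Form.Char_Poly" "HOL-Library.Multiset"
begin

section \<open>Cyclotomic polynomials\<close>

definition primitive_roots_of_unity :: "nat \<Rightarrow> complex set" where
  "primitive_roots_of_unity n = {z. z ^ n = 1 \<and> (\<forall>k. 0 < k \<and> k < n \<longrightarrow> z ^ k \<noteq> 1)}"

text \<open>Meaningful for \<open>n > 0\<close>; existence and uniqueness of the integer polynomial are
  established in \<open>cyclotomic_unique\<close> and \<open>of_int_poly_cyclotomic\<close> below.\<close>

definition cyclotomic :: "nat \<Rightarrow> int poly" where
  "cyclotomic n =
     (THE p. map_poly of_int p = (\<Prod>z\<in>primitive_roots_of_unity n. [:- z, 1:]))"

definition product_of_cyclotomics :: "int poly \<Rightarrow> bool" where
  "product_of_cyclotomics p \<longleftrightarrow>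
     (\<exists>M :: nat multiset. 0 \<notin># M \<and> p = prod_mset (image_mset cyclotomic M))"

lemma roots_of_unity_poly:
  assumes "n > 0"
  shows "(\<Prod>z\<in>{z::complex. z ^ n = 1}. [:- z, 1:]) = monom 1 n - 1"
proof -
  let ?R = "{z::complex. z ^ n = 1}" and ?P = "\<Prod>z\<in>{z::complex. z ^ n = 1}. [:- z, 1:]"
  have fin: "finite ?R" and card: "card ?R = n"
    using assms by (auto intro: finite_roots_unity card_roots_unity_eq)
  have degP: "degree ?P = n"
    by (subst degree_prod_eq_sum_degree) (auto simp: card)
  have lcP: "lead_coeff ?P = 1"
    by (subst lead_coeff_prod) simp
  let ?D = "?P - (monom 1 n - 1)"
  have "degree ?D < n \<or> ?D = 0"
  proof -
    have "degree (monom 1 n - 1 :: complex poly) \<le> n"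
      by (intro degree_diff_le) (auto simp: degree_monom_le)
    then have "degree ?D \<le> n" using degP by (intro degree_diff_le[of _ n "monom 1 n - 1"]) simp_all
    moreover have "coeff ?D n = 0" using lcP degP assms by simp
    ultimately show ?thesis
      by (metis leading_coeff_0_iff order_le_less)
  qed
  moreover have "poly ?D z = 0" if "z \<in> ?R" for z
    using that fin by (auto simp: poly_prod poly_monom)
  then have sub: "?R \<subseteq> {z. poly ?D z = 0}" by blast
  have "n \<le> degree ?D" if "?D \<noteq> 0"
    using card card_mono[OF poly_roots_finite[OF that] sub] card_poly_roots_bound[OF that]
    by linarith
  ultimately have "?D = 0" by (meson not_less)
  then show ?thesis by simp
qed

lemma roots_of_unity_partition:
  assumes "n > 0"
  shows "{z::complex. z ^ n = 1} = (\<Union>d\<in>{d. d dvd n}. primitive_roots_of_unity d)"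
proof (intro equalityI subsetI)
  fix z :: complex assume "z \<in> {z. z ^ n = 1}"
  then have z: "z ^ n = 1" by simp
  define d where "d = (LEAST d. d > 0 \<and> z ^ d = 1)"
  have d: "d > 0 \<and> z ^ d = 1" unfolding d_def by (rule LeastI[of _ n]) (use z assms in auto)
  have least: "z ^ k \<noteq> 1" if "0 < k" "k < d" for k
    using not_less_Least[of k "\<lambda>d. d > 0 \<and> z ^ d = 1"] that unfolding d_def by auto
  have "z ^ n = z ^ (d * (n div d) + n mod d)" by simp
  also have "\<dots> = z ^ (n mod d)" using d by (simp only: power_add power_mult) simp
  finally have "z ^ (n mod d) = 1" using z by simp
  then have "n mod d = 0" using least[of "n mod d"] d by auto
  then have "d dvd n" by auto
  then show "z \<in> (\<Union>d\<in>{d. d dvd n}. primitive_roots_of_unity d)"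
    using d least by (auto simp: primitive_roots_of_unity_def)
qed (auto simp: primitive_roots_of_unity_def power_mult elim!: dvdE)

lemma cyclotomic_unique:
  assumes "map_poly of_int p = (\<Prod>z\<in>primitive_roots_of_unity n. [:- z, 1:])"
  shows "cyclotomic n = p"
  unfolding cyclotomic_def
proof (rule the_equality)
  fix p' assume "map_poly of_int p' = (\<Prod>z\<in>primitive_roots_of_unity n. [:- z, 1:])"
  with assms have "(of_int_poly p' :: complex poly) = of_int_poly p" by simp
  then show "p' = p" by (simp add: poly_eq_iff coeff_map_poly)
qed (fact assms)

lemma primitive_roots_of_unity_integral:
  assumes "n > 0"
  shows "\<exists>p. map_poly of_int p = (\<Prod>z\<in>primitive_roots_of_unity n. [:- z, 1:])"
  using assms
proof (induction n rule: less_induct)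
  case (less n)
  let ?F = "\<lambda>n. \<Prod>z\<in>primitive_roots_of_unity n. [:- z, 1:]"
  let ?D = "{d. d dvd n}"
  have fin: "finite (primitive_roots_of_unity d)" if "d > 0" for d
    by (rule finite_subset[OF _ finite_roots_unity[of d]])
      (use that in \<open>auto simp: primitive_roots_of_unity_def\<close>)
  have pos: "d > 0" if "d dvd n" for d using that less.prems by (auto intro: Nat.gr0I)
  have disj: "primitive_roots_of_unity d \<inter> primitive_roots_of_unity e = {}"
    if "d > 0" "e > 0" "d \<noteq> e" for d e
    using that by (cases d e rule: linorder_cases) (auto simp: primitive_roots_of_unity_def)
  have finD: "finite ?D" using less.prems by simp
  have "monom 1 n - 1 = (\<Prod>d\<in>?D. ?F d)"
    unfolding roots_of_unity_poly[OF less.prems, symmetric] roots_of_unity_partition[OF less.prems]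
    by (rule prod.UNION_disjoint) (use finD fin pos disj in auto)
  also have "\<dots> = ?F n * (\<Prod>d\<in>?D - {n}. ?F d)"
    using finD by (subst prod.remove[of _ n]) auto
  finally have eq: "monom 1 n - 1 = ?F n * (\<Prod>d\<in>?D - {n}. ?F d)" .
  have "\<forall>d\<in>?D - {n}. \<exists>p. map_poly of_int p = ?F d"
  proof
    fix d assume "d \<in> ?D - {n}"
    then have "d < n" "0 < d" using pos dvd_imp_le[of d n] less.prems by auto
    then show "\<exists>p. map_poly of_int p = ?F d" by (rule less.IH)
  qed
  then obtain f where f: "map_poly of_int (f d) = ?F d" if "d \<in> ?D - {n}" for d
    by metis
  define Q where "Q = (\<Prod>d\<in>?D - {n}. f d)"
  have Q: "(of_int_poly Q :: complex poly) = (\<Prod>d\<in>?D - {n}. ?F d)"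
    unfolding Q_def of_int_poly_hom.hom_prod using f by (intro prod.cong) auto
  have "lead_coeff (of_int_poly Q :: complex poly) = 1"
    unfolding Q by (simp add: lead_coeff_prod)
  then have monic: "lead_coeff Q = 1" by simp
  then have Q0: "Q \<noteq> 0" by auto
  obtain q r where qr: "pseudo_divmod (monom 1 n - 1) Q = (q, r)" by force
  from pseudo_divmod[OF Q0 qr] monic
  have div: "monom 1 n - 1 = Q * q + r" and r: "r = 0 \<or> degree r < degree Q" by auto
  let ?h = "of_int_poly :: int poly \<Rightarrow> complex poly"
  have "?h (monom 1 n - 1) = ?h Q * ?h q + ?h r"
    unfolding div by (simp add: of_int_poly_hom.hom_add of_int_poly_hom.hom_mult)
  moreover have "?h (monom 1 n - 1) = monom 1 n - 1"
    by (simp add: of_int_poly_hom.hom_minus map_poly_monom)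
  ultimately have "?h Q * (?F n - ?h q) = ?h r"
    using eq Q by (simp add: algebra_simps)
  moreover have "?F n - ?h q = 0"
  proof (rule ccontr)
    assume nz: "?F n - ?h q \<noteq> 0"
    have "?h Q \<noteq> 0" using Q0 by simp
    then have "?h r \<noteq> 0" "degree (?h r) = degree (?h Q) + degree (?F n - ?h q)"
      using calculation nz by (metis mult_eq_0_iff, metis degree_mult_eq)
    then show False using r by simp
  qed
  ultimately show ?case by auto
qed

lemma of_int_poly_cyclotomic:
  assumes "n > 0"
  shows "map_poly of_int (cyclotomic n) = (\<Prod>z\<in>primitive_roots_of_unity n. [:- z, 1:])"
  using primitive_roots_of_unity_integral[OF assms] cyclotomic_unique by metis

lemma cyclotomic_1: "cyclotomic 1 = [:-1, 1:]"
proof (rule cyclotomic_unique)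
  have "primitive_roots_of_unity 1 = {1}" by (auto simp: primitive_roots_of_unity_def)
  then show "map_poly of_int [:-1, 1:] = (\<Prod>z\<in>primitive_roots_of_unity 1. [:- z, 1:])" by simp
qed

lemma cyclotomic_2: "cyclotomic 2 = [:1, 1:]"
proof (rule cyclotomic_unique)
  have "primitive_roots_of_unity 2 = {-1}"
    by (auto simp: primitive_roots_of_unity_def power2_eq_1_iff less_2_cases_iff)
  then show "map_poly of_int [:1, 1:] = (\<Prod>z\<in>primitive_roots_of_unity 2. [:- z, 1:])" by simp
qed

section \<open>Lattices\<close>

context Modules.module
begin

definition ordered_basis :: "'b list \<Rightarrow> 'b set \<Rightarrow> bool" where
  "ordered_basis bs M \<longleftrightarrow> distinct bs \<and> independent (set bs) \<and> span (set bs) = M"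

definition endo_matrix :: "'b list \<Rightarrow> ('b \<Rightarrow> 'b) \<Rightarrow> 'a mat" where
  "endo_matrix bs t =
     mat (length bs) (length bs) (\<lambda>(i, j). representation (set bs) (t (bs ! j)) (bs ! i))"

definition poly_endo :: "'a poly \<Rightarrow> ('b \<Rightarrow> 'b) \<Rightarrow> 'b \<Rightarrow> 'b" where
  "poly_endo p t x = (\<Sum>i\<le>degree p. coeff p i *s (t ^^ i) x)"

end

text \<open>The underlying free module is the whole type \<open>'a\<close>. The form is bilinear because it is
  symmetric and linear in its second argument.\<close>

locale integral_lattice = Modules.module scale
  for scale :: "int \<Rightarrow> 'a::ab_group_add \<Rightarrow> 'a" (infixr \<open>*s\<close> 75) +
  fixes q :: "'a \<Rightarrow> 'a \<Rightarrow> int"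
  assumes free: "\<exists>bs. ordered_basis bs UNIV"
    and sym: "q x y = q y x"
    and linear: "module_hom scale (*) (q x)"
begin

definition gram_matrix :: "'a list \<Rightarrow> int mat" where
  "gram_matrix bs = mat (length bs) (length bs) (\<lambda>(i, j). q (bs ! i) (bs ! j))"

text \<open>The notions below that refer to a basis do not depend on its choice.\<close>

definition unimodular :: bool where
  "unimodular \<longleftrightarrow> (\<exists>bs. ordered_basis bs UNIV \<and> det (gram_matrix bs) \<in> {1, -1})"

definition even_lattice :: bool where
  "even_lattice \<longleftrightarrow> (\<forall>x. even (q x x))"

text \<open>\<open>has_signature M r s\<close>: over the real numbers, the restriction of \<open>q\<close> to the finitely
  generated free submodule \<open>M\<close> diagonalizes with \<open>r\<close> positive and \<open>s\<close> negative entries.\<close>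

definition has_signature :: "'a set \<Rightarrow> nat \<Rightarrow> nat \<Rightarrow> bool" where
  "has_signature M r s \<longleftrightarrow>
     (\<exists>bs P. ordered_basis bs M \<and>
        P \<in> carrier_mat (length bs) (length bs) \<and> invertible_mat P \<and>
        (let D = transpose_mat P * map_mat real_of_int (gram_matrix bs) * P in
           diagonal_mat D \<and>
           card {i. i < length bs \<and> D $$ (i, i) > 0} = r \<and>
           card {i. i < length bs \<and> D $$ (i, i) < 0} = s))"

definition isometry :: "('a \<Rightarrow> 'a) \<Rightarrow> bool" where
  "isometry t \<longleftrightarrow> module_hom scale scale t \<and> bij t \<and> (\<forall>x y. q (t x) (t y) = q x y)"

definition has_char_poly :: "('a \<Rightarrow> 'a) \<Rightarrow> int poly \<Rightarrow> bool" where
  "has_char_poly t p \<longleftrightarrow> (\<exists>bs. ordered_basis bs UNIV \<and> char_poly (endo_matrix bs t) = p)"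

definition poly_kernel :: "int poly \<Rightarrow> ('a \<Rightarrow> 'a) \<Rightarrow> 'a set" where
  "poly_kernel p t = {x. poly_endo p t x = 0}"

end

end

theory Submission
  imports Defs "HOL-Library.FuncSet" "HOL-Number_Theory.Totient"
begin

text \<open>
  Let \<open>t\<close> be an isometry as in the statement and let \<open>M\<close> be the kernel of \<open>\<Phi>\<^sub>6\<^sub>0(t)\<close>, of
  signature \<open>(2, 14)\<close>. The point is that \<open>M\<close> has an even unimodular overlattice of the same rank,
  which is impossible: the signature of an even unimodular lattice is divisible by 8, and
  \<open>2 - 14 = -12\<close> is not.

  The overlattice comes from arithmetic at the prime 5. The degree of \<open>C'\<close> is 6. A cyclotomic
  polynomial of degree at most 6 is a unit modulo \<open>\<Phi>\<^sub>6\<^sub>0\<close>, except for \<open>\<Phi>\<^sub>1\<^sub>2\<close>, which occurs in \<open>C'\<close> at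
  most once and satisfies \<open>5 \<in> (\<Phi>\<^sub>1\<^sub>2, \<Phi>\<^sub>6\<^sub>0)\<close>. Since \<open>L\<close> is unimodular, it follows that the dual
  lattice of \<open>M\<close> satisfies \<open>\<Phi>\<^sub>1\<^sub>2(t) M\<^sup># \<subseteq> M\<close> and \<open>5 M\<^sup># \<subseteq> M\<close>. Modulo 5 the polynomial \<open>\<Phi>\<^sub>1\<^sub>2\<close> is the
  product of \<open>f = x\<^sup>2 + 2 x - 1\<close> and \<open>g = x\<^sup>2 - 2 x - 1\<close>, and these two factors are exchanged by
  \<open>x \<mapsto> 1/x\<close>, up to a unit. Hence the discriminant group \<open>M\<^sup># / M\<close> is the sum of the kernels of
  \<open>f(t)\<close> and \<open>g(t)\<close>, each of which is its own orthogonal complement, and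
  \<open>N = {w \<in> M\<^sup>#. g(t) w \<in> M}\<close> is even and unimodular. All of this is carried out inside \<open>M\<close>, by
  working with the multiples by 5: \<open>5 M\<^sup>#\<close> is \<open>dual5\<close> and \<open>5 N\<close> is \<open>neighbour5\<close>.

  The divisibility by 8 is obtained from Gauss sums. Choose pairwise orthogonal vectors
  \<open>b\<^sub>1, \<dots>, b\<^sub>1\<^sub>6\<close> of \<open>M\<close> with \<open>q(b\<^sub>i, b\<^sub>i) = 2 a\<^sub>i \<noteq> 0\<close>, and sum \<open>exp(\<pi> i q(x, x))\<close> over the
  discriminant group of the lattice that they span. The sum over the whole group is the product of
  one-dimensional Gauss sums, which equal \<open>\<surd>|a\<^sub>i| (1 \<plusminus> i)\<close> with the sign of \<open>a\<^sub>i\<close>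
  (\<open>signed_gauss_sum\<close>). On the other hand the summand is 1 on a self-dual subgroup, the image of
  \<open>N\<close>, so that the sum is the order of this subgroup (\<open>gauss_sum_self_dual\<close>). By the law of inertia
  two of the \<open>a\<^sub>i\<close> are positive and fourteen are negative, so that \<open>(1 + i)\<^sup>2 (1 - i)\<^sup>1\<^sup>4 = -256\<close>
  would have to be positive.
\<close>

section \<open>The quadratic Gauss sum\<close>

text \<open>
  This is half of the classical sum of \<open>exp(2 \<pi> i x\<^sup>2 / (4 m))\<close> over the residues modulo \<open>4 m\<close>: the
  summand has period \<open>2 m\<close>. It is the Gauss sum of the discriminant group of the lattice generated by
  one vector of norm \<open>2 m\<close>.
\<close>

definition gauss_sum :: "nat \<Rightarrow> complex" where
  "gauss_sum m = (\<Sum>x<2 * m. cis (pi * real x ^ 2 / (2 * real m)))"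

lemma cis_2pi_nat: "cis (2 * pi * real n) = 1"
  using cis_multiple_2pi[of "real n"] by simp

lemma cis_2pi_int: "cis (2 * pi * of_int n) = 1"
  using cis_multiple_2pi[of "of_int n"] by simp

lemma cis_2pi_eq_1_iff: "cis (2 * pi * t) = 1 \<longleftrightarrow> t \<in> \<int>"
proof
  assume "cis (2 * pi * t) = 1"
  then have "cos (2 * pi * t) = 1" by (simp add: complex_eq_iff)
  then obtain n :: int where "2 * pi * t = of_int n * 2 * pi"
    unfolding cos_one_2pi_int by blast
  then have "t = of_int n" by (simp add: field_simps)
  then show "t \<in> \<int>" by simp
next
  assume "t \<in> \<int>"
  then show "cis (2 * pi * t) = 1"
    by (elim Ints_cases) (simp add: cis_2pi_int)
qed

lemma sum_cis_multiples:
  fixes k y :: nat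
  assumes "k > 0"
  shows "(\<Sum>z<k. cis (2 * pi * (real y * real z / real k))) = (if k dvd y then of_nat k else 0)"
proof -
  let ?r = "cis (2 * pi * (real y / real k))"
  have eq: "cis (2 * pi * (real y * real z / real k)) = ?r ^ z" for z
    by (simp add: DeMoivre mult_ac)
  have "?r = 1 \<longleftrightarrow> k dvd y"
  proof -
    have "?r = 1 \<longleftrightarrow> real y / real k \<in> \<int>" by (rule cis_2pi_eq_1_iff)
    also have "\<dots> \<longleftrightarrow> k dvd y"
    proof
      assume "real y / real k \<in> \<int>"
      then obtain n :: int where "real y / real k = of_int n" by (elim Ints_cases)
      then have "real y = of_int n * real k" using assms by (simp add: field_simps)
      then have "of_int (int y) = (of_int (n * int k) :: real)" by simp
      then have "int y = n * int k" by (simp only: of_int_eq_iff)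
      then have "int k dvd int y" by simp
      then show "k dvd y" by simp
    qed (use assms in auto)
    finally show ?thesis .
  qed
  moreover have "real k * (2 * pi * (real y / real k)) = 2 * pi * real y"
    using assms by simp
  then have "?r ^ k = 1" by (simp only: DeMoivre cis_2pi_nat)
  ultimately show ?thesis
    unfolding eq using sum_gp_strict[of ?r k] by simp
qed

text \<open>
  Write the summation index as \<open>y + 2 m k z\<close> with \<open>y < 2 m k\<close> and \<open>z < k\<close>. The sum over \<open>z\<close> is a sum of
  \<open>k\<close>-th roots of unity, which leaves only the multiples \<open>y\<close> of \<open>k\<close>. The equation lets the quotient
  of the Gauss sum by \<open>\<surd>m\<close> be computed from arbitrarily large arguments.
\<close>

lemma gauss_sum_square_multiple:
  assumes m: "m > 0" and k: "k > 0"
  shows "gauss_sum (m * k ^ 2) = of_nat k * gauss_sum m"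
proof -
  let ?F = "\<lambda>x::nat. cis (pi * real x ^ 2 / (2 * real (m * k ^ 2)))"
  let ?N = "2 * m * k"
  have "gauss_sum (m * k ^ 2) = (\<Sum>x<k * ?N. ?F x)"
    by (simp add: gauss_sum_def power2_eq_square mult_ac)
  also have "\<dots> = (\<Sum>z<k. sum ?F {z * ?N ..< z * ?N + ?N})"
    by (rule sum.nat_group[symmetric])
  also have "\<dots> = (\<Sum>z<k. \<Sum>y<?N. ?F (y + z * ?N))"
  proof (rule sum.cong)
    fix z
    show "sum ?F {z * ?N ..< z * ?N + ?N} = (\<Sum>y<?N. ?F (y + z * ?N))"
      using sum.shift_bounds_nat_ivl[of ?F 0 "z * ?N" ?N]
      by (simp add: atLeast0LessThan add.commute)
  qed simp
  also have "\<dots> = (\<Sum>z<k. \<Sum>y<?N. ?F y * cis (2 * pi * (real y * real z / real k)))"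
  proof (intro sum.cong refl)
    fix z y :: nat
    have "pi * real (y + z * ?N) ^ 2 / (2 * real (m * k ^ 2)) =
        pi * real y ^ 2 / (2 * real (m * k ^ 2)) + 2 * pi * (real y * real z / real k) +
        2 * pi * real (m * z ^ 2)"
      using m k by (simp add: field_simps power2_eq_square)
    then show "?F (y + z * ?N) = ?F y * cis (2 * pi * (real y * real z / real k))"
      by (simp only: cis_mult[symmetric] cis_2pi_nat) simp
  qed
  also have "\<dots> = (\<Sum>y<?N. ?F y * (\<Sum>z<k. cis (2 * pi * (real y * real z / real k))))"
    by (subst sum.swap) (simp add: sum_distrib_left)
  also have "\<dots> = (\<Sum>y<?N. if k dvd y then ?F y * of_nat k else 0)"
    by (simp only: sum_cis_multiples[OF k]) (simp add: if_distrib cong: if_cong)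
  also have "\<dots> = (\<Sum>y\<in>{y. y < ?N \<and> k dvd y}. ?F y * of_nat k)"
    by (simp add: sum.If_cases Int_def)
  also have "\<dots> = (\<Sum>w<2 * m. ?F (k * w) * of_nat k)"
    by (rule sum.reindex_bij_witness[of _ "\<lambda>w. k * w" "\<lambda>y. y div k"])
      (use k in \<open>auto simp: less_mult_imp_div_less mult.commute elim!: dvdE\<close>)
  also have "\<dots> = of_nat k * gauss_sum m"
    unfolding gauss_sum_def sum_distrib_left
    by (rule sum.cong) (use m k in \<open>auto simp: field_simps power2_eq_square\<close>)
  finally show ?thesis .
qed

lemma abel_summation_bound:
  fixes a :: "nat \<Rightarrow> real" and g :: "nat \<Rightarrow> complex"
  assumes "X \<le> Y"
    and dec: "\<And>x. X \<le> x \<Longrightarrow> x < Y \<Longrightarrow> a (Suc x) \<le> a x"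
    and nonneg: "a Y \<ge> 0"
    and g: "\<And>x. norm (g x) \<le> B"
  shows "norm (\<Sum>x=X..Y. of_real (a x) * (g (Suc x) - g x)) \<le> 2 * B * a X"
proof -
  let ?S = "\<lambda>Y. \<Sum>x=X..Y. of_real (a x) * (g (Suc x) - g x)"
  have *: "norm (?S Y - of_real (a Y) * g (Suc Y)) \<le> B * (2 * a X - a Y)"
    if "X \<le> Y" "\<And>x. X \<le> x \<Longrightarrow> x < Y \<Longrightarrow> a (Suc x) \<le> a x" "a X \<ge> 0" for Y
    using that
  proof (induction Y rule: dec_induct)
    case base
    have "norm (?S X - of_real (a X) * g (Suc X)) = a X * norm (g X)"
      using base by (simp add: algebra_simps norm_mult)
    also have "\<dots> \<le> a X * B" using base g by (intro mult_left_mono) auto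
    finally show ?case by (simp add: algebra_simps)
  next
    case (step Y)
    have "?S (Suc Y) - of_real (a (Suc Y)) * g (Suc (Suc Y)) =
        (?S Y - of_real (a Y) * g (Suc Y)) + of_real (a Y - a (Suc Y)) * g (Suc Y)"
      using step.hyps by (simp add: algebra_simps)
    also have "norm \<dots> \<le> B * (2 * a X - a Y) + (a Y - a (Suc Y)) * B"
    proof (rule norm_triangle_mono)
      show "norm (?S Y - of_real (a Y) * g (Suc Y)) \<le> B * (2 * a X - a Y)"
        using step by auto
      have "norm (of_real (a Y - a (Suc Y)) * g (Suc Y)) = (a Y - a (Suc Y)) * norm (g (Suc Y))"
        using step.prems(1)[of Y] step.hyps by (simp add: norm_mult del: of_real_diff)
      also have "\<dots> \<le> (a Y - a (Suc Y)) * B"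
        using step.prems(1)[of Y] step.hyps g by (intro mult_left_mono) auto
      finally show "norm (of_real (a Y - a (Suc Y)) * g (Suc Y)) \<le> (a Y - a (Suc Y)) * B" .
    qed
    finally show ?case by (simp add: algebra_simps)
  qed
  have "a Y \<le> a X" using assms(1,2)
    by (induction Y rule: dec_induct) (auto intro: order_trans)
  have "norm (?S Y) \<le> norm (?S Y - of_real (a Y) * g (Suc Y)) + norm (of_real (a Y) * g (Suc Y))"
    using norm_triangle_sub[of "?S Y" "of_real (a Y) * g (Suc Y)"] by (simp only: add.commute)
  also have "\<dots> \<le> B * (2 * a X - a Y) + a Y * B"
    using \<open>a Y \<le> a X\<close> assms g by (intro add_mono *) (auto simp: norm_mult intro: mult_left_mono)
  finally show ?thesis by (simp add: algebra_simps)
qed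

text \<open>
  With \<open>v = \<pi> u / 4\<close>, the mean value theorem gives \<open>sin v \<ge> v cos v\<close>, so that
  \<open>sin 2v \<ge> 2 v cos\<^sup>2 v = v (1 + cos 2v) \<ge> v\<close>.
\<close>

lemma sin_half_pi_lower:
  fixes u :: real
  assumes "0 \<le> u" "u \<le> 1"
  shows "u / 2 \<le> sin (pi * u / 2)"
proof -
  define v where "v = pi * u / 4"
  have "pi * u \<le> pi * 1" using assms by (intro mult_left_mono) auto
  then have v: "0 \<le> v" "v \<le> pi / 4" using assms by (auto simp: v_def)
  have sin_v: "v * cos v \<le> sin v"
  proof (cases "v = 0")
    case False
    then obtain z where z: "0 < z" "z < v" "sin v - sin 0 = (v - 0) * cos z"
      using MVT2[of 0 v sin cos] v by (auto intro: DERIV_sin)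
    have "cos v \<le> cos z" using z v by (intro cos_monotone_0_pi_le) auto
    then have "v * cos v \<le> v * cos z" using v by (intro mult_left_mono) auto
    then show ?thesis using z by simp
  qed simp
  have "cos v \<ge> 0" "cos (2 * v) \<ge> 0" using v by (auto intro!: cos_ge_zero)
  have "u / 2 \<le> v" using assms pi_ge_two mult_right_mono[of 2 pi u] by (simp add: v_def)
  also have "\<dots> \<le> v * (1 + cos (2 * v))"
    using mult_left_mono[of 1 "1 + cos (2 * v)" v] v \<open>cos (2 * v) \<ge> 0\<close> by simp
  also have "\<dots> = 2 * (v * cos v) * cos v"
    by (simp add: cos_double_cos power2_eq_square)
  also have "\<dots> \<le> 2 * sin v * cos v"
    using sin_v \<open>cos v \<ge> 0\<close> by (intro mult_right_mono mult_left_mono) auto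
  also have "\<dots> = sin (2 * v)" by (simp add: sin_double)
  also have "2 * v = pi * u / 2" by (simp add: v_def)
  finally show ?thesis .
qed

text \<open>
  The summand at \<open>x\<close> is, up to a constant of modulus 1, the difference of the same exponential at
  \<open>x + 1/2\<close> and \<open>x - 1/2\<close>, divided by \<open>2 i sin(\<pi> x / (2 m))\<close>. The divisor increases with \<open>x\<close>, so that
  summation by parts bounds the sum by its inverse at the lower end.
\<close>

lemma gauss_sum_tail_bound:
  assumes X: "X > 0" "X \<le> m"
  shows "norm (\<Sum>x=X..m. cis (pi * real x ^ 2 / (2 * real m))) \<le> 2 * real m / real X"
proof -
  have m: "m > 0" using X by simp
  define a where "a x = 1 / sin (pi * (real x / real m) / 2)" for x
  define g where "g x = cis (pi * (real x - 1/2) ^ 2 / (2 * real m) - pi / (8 * real m)) / (2 * \<i>)"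
    for x
  have sin_lower: "real x / real m / 2 \<le> sin (pi * (real x / real m) / 2)" if "x \<le> m" for x
    using that m by (intro sin_half_pi_lower) auto
  have sin_pos: "sin (pi * (real x / real m) / 2) > 0" if "0 < x" "x \<le> m" for x
    using sin_lower[OF that(2)] that m by (smt (verit) divide_pos_pos of_nat_0_less_iff)
  have "cis (pi * real x ^ 2 / (2 * real m)) = of_real (a x) * (g (Suc x) - g x)"
    if "0 < x" "x \<le> m" for x
  proof -
    let ?A = "pi * real x ^ 2 / (2 * real m)" and ?s = "pi * (real x / real m) / 2"
    have 1: "pi * (real (Suc x) - 1/2) ^ 2 / (2 * real m) - pi / (8 * real m) = ?A + ?s"
      using m by (simp add: field_simps power2_eq_square)
    have 2: "pi * (real x - 1/2) ^ 2 / (2 * real m) - pi / (8 * real m) = ?A + (- ?s)"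
      using m by (simp add: field_simps power2_eq_square)
    have "g (Suc x) - g x = cis ?A * ((cis ?s - cis (- ?s)) / (2 * \<i>))"
      unfolding g_def 1 2 cis_mult[symmetric] by (simp add: field_simps)
    also have "(cis ?s - cis (- ?s)) / (2 * \<i>) = of_real (sin ?s)"
      by (simp add: complex_eq_iff)
    finally show ?thesis using sin_pos[OF that] by (simp add: a_def)
  qed
  then have "(\<Sum>x=X..m. cis (pi * real x ^ 2 / (2 * real m))) =
      (\<Sum>x=X..m. of_real (a x) * (g (Suc x) - g x))"
    using X by (intro sum.cong) auto
  also have "norm \<dots> \<le> 2 * (1/2) * a X"
  proof (rule abel_summation_bound)
    show "a (Suc x) \<le> a x" if "X \<le> x" "x < m" for x
    proof -
      have "sin (pi * (real x / real m) / 2) \<le> sin (pi * (real (Suc x) / real m) / 2)"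
      proof (rule sin_monotone_2pi_le)
        show "- (pi / 2) \<le> pi * (real x / real m) / 2"
          by (rule order_trans[of _ 0]) auto
        have "real (Suc x) / real m \<le> 1" using that m by simp
        then show "pi * (real (Suc x) / real m) / 2 \<le> pi / 2"
          using mult_left_mono[of "real (Suc x) / real m" 1 pi] by simp
      qed (use m in \<open>auto simp: divide_right_mono\<close>)
      then show ?thesis
        using sin_pos[of x] that X unfolding a_def by (intro divide_left_mono) auto
    qed
    show "a m \<ge> 0" using sin_pos[of m] m by (simp add: a_def)
    show "norm (g x) \<le> 1/2" for x by (simp add: g_def norm_divide norm_mult)
  qed (use X in auto)
  also have "\<dots> \<le> 2 * real m / real X"
  proof -
    have "1 / sin (pi * (real X / real m) / 2) \<le> 1 / (real X / real m / 2)"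
      using sin_lower[OF X(2)] sin_pos[OF X] X m
      by (intro divide_left_mono mult_pos_pos) (auto simp del: times_divide_eq_right)
    then show ?thesis by (simp add: a_def mult.commute)
  qed
  finally show ?thesis .
qed

text \<open>
  By the symmetry \<open>x \<mapsto> 2 m - x\<close> the Gauss sum is twice the sum up to \<open>m\<close>, apart from the two fixed
  points; the part beyond \<open>X\<close> is the tail.
\<close>

lemma gauss_sum_initial_segment:
  assumes X: "X > 0" "X \<le> m"
  shows "norm (gauss_sum m - 2 * (\<Sum>x<X. cis (pi * real x ^ 2 / (2 * real m)))) \<le>
    2 + 4 * real m / real X"
proof -
  have m: "m > 0" using X by simp
  let ?F = "\<lambda>x::nat. cis (pi * real x ^ 2 / (2 * real m))"
  have refl: "?F (2 * m - x) = ?F x" if "x \<le> 2 * m" for x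
  proof -
    have "pi * real (2 * m - x) ^ 2 / (2 * real m) =
        pi * real x ^ 2 / (2 * real m) + 2 * pi * of_int (int m - int x)"
      using that m by (simp add: of_nat_diff field_simps power2_eq_square)
    then show ?thesis by (simp only: cis_mult[symmetric] cis_2pi_int) simp
  qed
  have "gauss_sum m = sum ?F {..<m} + sum ?F {m..<2 * m}"
    unfolding gauss_sum_def lessThan_atLeast0 by (rule sum.atLeastLessThan_concat[symmetric]) auto
  also have "sum ?F {m..<2 * m} = sum ?F {1..m}"
    by (rule sum.reindex_bij_witness[of _ "\<lambda>x. 2 * m - x" "\<lambda>x. 2 * m - x"])
      (use refl in auto)
  also have "{..<m} = {..m} - {m}" by auto
  also have "{1..m} = {..m} - {0}" by auto
  finally have "gauss_sum m = 2 * sum ?F {..m} - 1 - ?F m"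
    by (simp add: sum_diff1)
  moreover have "sum ?F {..m} = sum ?F {..<X} + sum ?F {X..m}"
    unfolding lessThan_Suc_atMost[symmetric] lessThan_atLeast0
      atLeastLessThanSuc_atLeastAtMost[symmetric]
    by (rule sum.atLeastLessThan_concat[symmetric]) (use X in auto)
  ultimately have "gauss_sum m - 2 * sum ?F {..<X} = 2 * sum ?F {X..m} - 1 - ?F m"
    by (simp add: algebra_simps)
  also have "norm \<dots> \<le> norm (2 * sum ?F {X..m} - 1) + norm (?F m)"
    by (rule norm_triangle_ineq4)
  also have "\<dots> \<le> norm (2 * sum ?F {X..m}) + norm (1 :: complex) + norm (?F m)"
    by (intro add_right_mono norm_triangle_ineq4)
  also have "\<dots> \<le> 2 + 4 * real m / real X"
    using gauss_sum_tail_bound[OF X] by (simp add: norm_mult)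
  finally show ?thesis .
qed

lemma norm_cis_diff_le: "norm (cis s - cis t) \<le> \<bar>s - t\<bar>"
proof -
  define u where "u = (s - t) / 2"
  have st: "s - t = 2 * u" by (simp add: u_def)
  have "norm (cis s - cis t) ^ 2 = (cos s - cos t) ^ 2 + (sin s - sin t) ^ 2"
    by (simp add: cmod_power2)
  also have "\<dots> = (sin s ^ 2 + cos s ^ 2) + (sin t ^ 2 + cos t ^ 2) - 2 * cos (s - t)"
    unfolding cos_diff by (simp add: power2_eq_square ring_distribs)
  also have "\<dots> = 2 - 2 * cos (s - t)"
    by (simp only: sin_cos_squared_add)
  also have "\<dots> = (2 * \<bar>sin u\<bar>) ^ 2"
    unfolding st cos_double_sin by (simp add: power_mult_distrib)
  also have "\<dots> \<le> \<bar>s - t\<bar> ^ 2"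
    unfolding st using abs_sin_x_le_abs_x[of u] by (intro power_mono) (auto simp: abs_mult)
  finally show ?thesis by (rule power2_le_imp_le) simp
qed

text \<open>
  The quotient of the Gauss sum of \<open>m\<close> by \<open>\<surd>m\<close> does not change when \<open>m\<close> is multiplied by a square.
  So the value at \<open>a\<close> can be read off from \<open>a k\<^sup>2\<close>, and the value at \<open>1\<close> from \<open>l\<^sup>2\<close>, where
  \<open>l\<close> is the integer part of \<open>r = k \<surd>a\<close>. As \<open>a k\<^sup>2\<close> and \<open>l\<^sup>2\<close> are relatively close for large \<open>k\<close>, the
  initial segments of length \<open>K l\<close> of the two sums are close as well, while the remaining terms
  contribute \<open>O(1/K)\<close>. Hence the quotient is the same for \<open>a\<close> and for \<open>1\<close>, where it is \<open>1 + i\<close>.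
\<close>

lemma gauss_sum_eq:
  assumes a: "a > 0"
  shows "gauss_sum a = of_real (sqrt (real a)) * (1 + \<i>)"
proof -
  have close: "norm (gauss_sum 1 - gauss_sum a / of_real (sqrt (real a))) \<le> 30 / real K"
    if K: "K > 0" for K
  proof -
    \<comment> \<open>The errors below involve \<open>K ^ 3 / k\<close>, which should be at most \<open>1 / K\<close>.\<close>
    define k where "k = K ^ 4"
    define r where "r = sqrt (real (a * k ^ 2))"
    define l where "l = nat \<lfloor>r\<rfloor>"
    define X where "X = K * l"
    have k: "k > 0" using K by (simp add: k_def)
    have r: "r > 0" unfolding r_def using a k by simp
    have l1: "real l \<le> r" and l2: "r < real l + 1"
      using r unfolding l_def by linarith+
    have r2: "r ^ 2 = real (a * k ^ 2)" unfolding r_def by simp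
    have rk: "r = sqrt (real a) * real k" unfolding r_def by (simp add: real_sqrt_mult)
    have "real k \<le> r"
      unfolding r_def using a by (intro real_le_rsqrt) (simp add: mult_le_cancel_right1)
    then have kl: "k \<le> l" unfolding l_def by (simp add: le_nat_floor)
    have "K \<le> k" using K unfolding k_def by (simp add: self_le_power)
    have l: "l > 0" using kl k by simp
    have "X > 0" "X \<le> l ^ 2"
      using K l kl \<open>K \<le> k\<close> by (auto simp: X_def power2_eq_square)
    moreover have "real (l ^ 2) \<le> real (a * k ^ 2)"
      unfolding r2[symmetric] of_nat_power using l1 by (intro power_mono) auto
    then have "l ^ 2 \<le> a * k ^ 2" by (simp only: of_nat_le_iff)
    ultimately have X: "X > 0" "X \<le> l ^ 2" "X \<le> a * k ^ 2" by auto
    let ?F1 = "\<lambda>x::nat. cis (pi * real x ^ 2 / (2 * real (l ^ 2)))"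
    let ?F2 = "\<lambda>x::nat. cis (pi * real x ^ 2 / (2 * real (a * k ^ 2)))"
    have g1: "gauss_sum (l ^ 2) = of_nat l * gauss_sum 1"
      using gauss_sum_square_multiple[of 1 l] l by simp
    have g2: "gauss_sum (a * k ^ 2) = of_nat k * gauss_sum a"
      using gauss_sum_square_multiple[of a k] a k by simp
    have "gauss_sum 1 - 2 * sum ?F1 {..<X} / of_nat l =
        (gauss_sum (l ^ 2) - 2 * sum ?F1 {..<X}) / of_nat l"
      unfolding g1 using l by (simp add: field_simps)
    also have "norm \<dots> \<le> (2 + 4 * real (l ^ 2) / real X) / real l"
      using gauss_sum_initial_segment[OF X(1,2)] by (simp add: norm_divide divide_right_mono)
    also have "\<dots> = 2 / real l + 4 / real K"
      using l K by (simp add: X_def field_simps power2_eq_square)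
    finally have A: "norm (gauss_sum 1 - 2 * sum ?F1 {..<X} / of_nat l) \<le> 2 / real l + 4 / real K" .
    have "gauss_sum a / of_real (sqrt (real a)) - 2 * sum ?F2 {..<X} / of_real r =
        (gauss_sum (a * k ^ 2) - 2 * sum ?F2 {..<X}) / of_real r"
      unfolding g2 rk using a k by (simp add: field_simps)
    also have "norm \<dots> \<le> (2 + 4 * real (a * k ^ 2) / real X) / r"
      using gauss_sum_initial_segment[OF X(1,3)] r by (simp add: norm_divide divide_right_mono)
    also have "\<dots> = 2 / r + 4 / real K * (r / real l)"
      unfolding r2[symmetric] using l K r by (simp add: X_def field_simps power2_eq_square)
    also have "\<dots> \<le> 2 / real l + 4 / real K * 2"
      using l1 l2 l by (intro add_mono divide_left_mono mult_left_mono) (auto simp: field_simps)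
    finally have B: "norm (gauss_sum a / of_real (sqrt (real a)) - 2 * sum ?F2 {..<X} / of_real r)
        \<le> 2 / real l + 8 / real K" by simp
    have "norm (sum ?F1 {..<X} / of_nat l - sum ?F2 {..<X} / of_real r) \<le>
        (\<Sum>x<X. norm (?F1 x / of_nat l - ?F2 x / of_real r))"
      unfolding sum_divide_distrib sum_subtractf[symmetric] by (rule norm_sum)
    also have "\<dots> \<le> (\<Sum>x<X. 6 * real X ^ 2 / real l ^ 4 + 1 / real l ^ 2)"
    proof (rule sum_mono)
      fix x assume "x \<in> {..<X}"
      then have x: "real x ^ 2 \<le> real X ^ 2" by (intro power_mono) auto
      have 0: "1 / real l ^ 2 - 1 / r ^ 2 \<ge> 0"
        using l l1 by (simp add: frac_le power_mono)
      have "1 / real l ^ 2 - 1 / r ^ 2 = (r ^ 2 - real l ^ 2) / (real l ^ 2 * r ^ 2)"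
        using l r by (simp add: field_simps)
      also have "\<dots> \<le> (3 * real l) / (real l ^ 2 * real l ^ 2)"
      proof (rule frac_le)
        have "r ^ 2 \<le> (real l + 1) ^ 2" using l2 r by (intro power_mono) auto
        then show "r ^ 2 - real l ^ 2 \<le> 3 * real l"
          using l by (simp add: power2_eq_square algebra_simps)
        show "real l ^ 2 * real l ^ 2 \<le> real l ^ 2 * r ^ 2"
          using l1 by (intro mult_left_mono power_mono) auto
      qed (use l in auto)
      also have "\<dots> = 3 / real l ^ 3" using l by (simp add: field_simps power2_eq_square power3_eq_cube)
      finally have d: "1 / real l ^ 2 - 1 / r ^ 2 \<le> 3 / real l ^ 3" .
      have "norm (?F1 x - ?F2 x) \<le>
          \<bar>pi * real x ^ 2 / (2 * real (l ^ 2)) - pi * real x ^ 2 / (2 * real (a * k ^ 2))\<bar>"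
        by (rule norm_cis_diff_le)
      also have "\<dots> = \<bar>pi / 2 * real x ^ 2 * (1 / real l ^ 2 - 1 / r ^ 2)\<bar>"
        unfolding r2[symmetric] by (simp add: algebra_simps)
      also have "\<dots> = pi / 2 * real x ^ 2 * (1 / real l ^ 2 - 1 / r ^ 2)"
        using 0 by simp
      also have "\<dots> \<le> 2 * real X ^ 2 * (3 / real l ^ 3)"
        using d x 0 pi_less_4 by (intro mult_mono) auto
      finally have e: "norm (?F1 x - ?F2 x) \<le> 6 * real X ^ 2 / real l ^ 3" by simp
      have "?F1 x / of_nat l - ?F2 x / of_real r =
          (?F1 x - ?F2 x) / of_nat l + ?F2 x * of_real (1 / real l - 1 / r)"
        by (simp add: diff_divide_distrib algebra_simps)
      also have "norm \<dots> \<le> norm (?F1 x - ?F2 x) / real l + \<bar>1 / real l - 1 / r\<bar>"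
        by (rule order_trans[OF norm_triangle_ineq]) (simp add: norm_mult norm_divide del: of_real_diff)
      also have "\<dots> \<le> 6 * real X ^ 2 / real l ^ 3 / real l + 1 / real l ^ 2"
      proof (rule add_mono)
        show "norm (?F1 x - ?F2 x) / real l \<le> 6 * real X ^ 2 / real l ^ 3 / real l"
          using e by (rule divide_right_mono) simp
        have "\<bar>1 / real l - 1 / r\<bar> = (r - real l) / (real l * r)"
          using l r l1 by (simp add: frac_le divide_simps)
        also have "\<dots> \<le> 1 / (real l * real l)"
          using l r l1 l2 by (intro frac_le) auto
        finally show "\<bar>1 / real l - 1 / r\<bar> \<le> 1 / real l ^ 2" by (simp add: power2_eq_square)
      qed
      finally show "norm (?F1 x / of_nat l - ?F2 x / of_real r) \<le>
          6 * real X ^ 2 / real l ^ 4 + 1 / real l ^ 2"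
        by (simp add: power_numeral_reduce)
    qed
    also have "\<dots> = 6 * real K ^ 3 / real l + real K / real l"
      using l by (simp add: X_def field_simps power_numeral_reduce)
    finally have C: "norm (sum ?F1 {..<X} / of_nat l - sum ?F2 {..<X} / of_real r) \<le>
        6 * real K ^ 3 / real l + real K / real l" .
    have Kl: "real K ^ 4 \<le> real l" using kl by (simp add: k_def flip: of_nat_power)
    have small: "real K ^ i / real l \<le> 1 / real K" if "i \<le> 3" for i
    proof -
      have "real K ^ Suc i \<le> real K ^ 4" using K that by (intro power_increasing) auto
      then have "real K ^ i * real K \<le> real l" using Kl by (simp only: power_Suc2)
      then show ?thesis using K l by (simp add: field_simps)
    qed
    have split: "gauss_sum 1 - gauss_sum a / of_real (sqrt (real a)) =
        (gauss_sum 1 - 2 * sum ?F1 {..<X} / of_nat l)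
        + 2 * (sum ?F1 {..<X} / of_nat l - sum ?F2 {..<X} / of_real r)
        - (gauss_sum a / of_real (sqrt (real a)) - 2 * sum ?F2 {..<X} / of_real r)"
      by (simp add: algebra_simps)
    have "norm (gauss_sum 1 - gauss_sum a / of_real (sqrt (real a))) \<le>
        norm (gauss_sum 1 - 2 * sum ?F1 {..<X} / of_nat l)
        + norm (2 * (sum ?F1 {..<X} / of_nat l - sum ?F2 {..<X} / of_real r))
        + norm (gauss_sum a / of_real (sqrt (real a)) - 2 * sum ?F2 {..<X} / of_real r)"
      unfolding split
      by (rule order_trans[OF norm_triangle_ineq4 add_right_mono[OF norm_triangle_ineq]])
    also have "\<dots> \<le> (2 / real l + 4 / real K) + 2 * (6 * real K ^ 3 / real l + real K / real l)
        + (2 / real l + 8 / real K)"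
      by (rule add_mono[OF add_mono[OF A] B]) (use C in \<open>simp only: norm_mult norm_numeral\<close>, simp)
    also have "\<dots> \<le> 30 / real K"
      using small[of 0] small[of 1] small[of 3] by simp
    finally show ?thesis .
  qed
  have "gauss_sum 1 - gauss_sum a / of_real (sqrt (real a)) = 0" (is "?d = 0")
  proof (rule ccontr)
    assume "?d \<noteq> 0"
    obtain K :: nat where K: "30 / norm ?d < real K"
      using reals_Archimedean2 by blast
    have "0 \<le> 30 / norm ?d" by (rule divide_nonneg_nonneg) auto
    then have "0 < real K" using K by (rule le_less_trans)
    then have "norm ?d * real K \<le> 30" using close[of K] by (simp only: of_nat_0_less_iff pos_le_divide_eq)
    moreover have "0 < norm ?d" using \<open>?d \<noteq> 0\<close> by (simp only: zero_less_norm_iff not_False_eq_True)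
    then have "30 < norm ?d * real K" using K by (simp only: pos_divide_less_eq mult.commute)
    ultimately show False by linarith
  qed
  moreover have "gauss_sum 1 = 1 + \<i>"
    by (simp add: gauss_sum_def numeral_2_eq_2 lessThan_Suc)
  ultimately show ?thesis using a by (simp add: field_simps)
qed

section \<open>Gauss sums of quadratic forms with a self-dual overlattice\<close>

lemma cis_square_periodic:
  fixes a x y :: int
  assumes "a \<noteq> 0" "2 * a dvd x - y"
  shows "cis (pi * of_int x ^ 2 / (2 * of_int a)) = cis (pi * of_int y ^ 2 / (2 * of_int a))"
proof -
  obtain k where "x - y = 2 * a * k" using assms(2) by (elim dvdE)
  then have x: "x = y + 2 * a * k" by simp
  have "pi * of_int x ^ 2 / (2 * of_int a) =
      pi * of_int y ^ 2 / (2 * of_int a) + 2 * pi * of_int (y * k + a * k ^ 2)"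
    unfolding x using assms(1) by (simp add: field_simps power2_eq_square)
  then show ?thesis by (simp only: cis_mult[symmetric] cis_2pi_int) simp
qed

lemma cis_product_periodic:
  fixes a c x y :: int
  assumes "a \<noteq> 0" "2 * a dvd x - y"
  shows "cis (pi * of_int (c * x) / of_int a) = cis (pi * of_int (c * y) / of_int a)"
proof -
  obtain k where "x - y = 2 * a * k" using assms(2) by (elim dvdE)
  then have x: "x = y + 2 * a * k" by simp
  have "pi * of_int (c * x) / of_int a = pi * of_int (c * y) / of_int a + 2 * pi * of_int (c * k)"
    unfolding x using assms(1) by (simp add: field_simps)
  then show ?thesis by (simp only: cis_mult[symmetric] cis_2pi_int) simp
qed

lemma prod_cis: "(\<Prod>i\<in>I. cis (f i)) = cis (\<Sum>i\<in>I. f i)"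
  by (induction I rule: infinite_finite_induct) (simp_all add: cis_mult)

lemma signed_gauss_sum:
  fixes a :: int
  assumes "a \<noteq> 0"
  shows "(\<Sum>x=0..<2 * \<bar>a\<bar>. cis (pi * of_int x ^ 2 / (2 * of_int a))) =
    of_real (sqrt (of_int \<bar>a\<bar>)) * (if a > 0 then 1 + \<i> else 1 - \<i>)"
proof -
  define n where "n = nat \<bar>a\<bar>"
  have n: "n > 0" "int n = \<bar>a\<bar>" using assms by (auto simp: n_def)
  have "(\<Sum>x=0..<2 * \<bar>a\<bar>. cis (pi * of_int x ^ 2 / (2 * of_int a))) =
      (\<Sum>x<2 * n. cis (pi * real x ^ 2 / (2 * of_int a)))"
    by (rule sum.reindex_bij_witness[of _ int nat]) (use n in auto)
  also have "\<dots> = (if a > 0 then gauss_sum n else cnj (gauss_sum n))"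
  proof (cases "a > 0")
    case True
    then have "a = int n" using n by simp
    then show ?thesis using True by (simp add: gauss_sum_def)
  next
    case False
    then have "a = - int n" using n by simp
    then show ?thesis using False by (simp add: gauss_sum_def flip: cis_cnj)
  qed
  also have "\<dots> = of_real (sqrt (of_int \<bar>a\<bar>)) * (if a > 0 then 1 + \<i> else 1 - \<i>)"
    unfolding gauss_sum_eq[OF n(1)] n(2)[symmetric] by simp
  finally show ?thesis .
qed

text \<open>
  The functions \<open>c\<close> on \<open>I\<close> are the coordinates of the vectors in the dual of the orthogonal lattice
  spanned by vectors \<open>b\<^sub>i\<close> of norm \<open>2 a\<^sub>i\<close>, and \<open>H\<close> is an even unimodular lattice between the two. Let
  \<open>Q\<close> be the exponential of \<open>\<pi> i\<close> times the norm, and \<open>\<chi>\<close> the associated bicharacter. Translating by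
  \<open>h \<in> H\<close> permutes the finite discriminant group and turns the summand \<open>Q c\<close> into \<open>Q c * \<chi> c h\<close>.
  Averaging over \<open>h\<close> kills every \<open>c\<close> outside the annihilator of \<open>H\<close>, that is, outside \<open>H\<close>, and \<open>Q\<close> is
  \<open>1\<close> on \<open>H\<close>. So the sum is the order of the image of \<open>H\<close> in the discriminant group.
\<close>

lemma gauss_sum_self_dual:
  fixes a :: "'i \<Rightarrow> int" and H :: "('i \<Rightarrow> int) set"
  assumes fin: "finite I"
    and nz: "\<And>i. i \<in> I \<Longrightarrow> a i \<noteq> 0"
    and diff: "\<And>c d. c \<in> H \<Longrightarrow> d \<in> H \<Longrightarrow> (\<lambda>i. c i - d i) \<in> H"
    and lattice: "\<And>c. (\<And>i. i \<in> I \<Longrightarrow> 2 * a i dvd c i) \<Longrightarrow> c \<in> H"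
    and isotropic: "\<And>h. h \<in> H \<Longrightarrow> (\<Sum>i\<in>I. of_int (h i) ^ 2 / (4 * of_int (a i)) :: real) \<in> \<int>"
    and self_dual: "\<And>c. (\<And>h. h \<in> H \<Longrightarrow>
        (\<Sum>i\<in>I. of_int (c i * h i) / (2 * of_int (a i)) :: real) \<in> \<int>) \<Longrightarrow> c \<in> H"
  shows "\<exists>N>0. (\<Prod>i\<in>I. \<Sum>x=0..<2 * \<bar>a i\<bar>. cis (pi * of_int x ^ 2 / (2 * of_int (a i)))) = of_nat N"
proof -
  \<comment> \<open>The box is a system of representatives of the discriminant group, \<open>red\<close> the reduction to it.\<close>
  define box where "box = (\<Pi>\<^sub>E i\<in>I. {0..<2 * \<bar>a i\<bar>})"
  define red where "red c = (\<lambda>i\<in>I. c i mod (2 * \<bar>a i\<bar>))" for c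
  define Q where "Q c = (\<Prod>i\<in>I. cis (pi * of_int (c i) ^ 2 / (2 * of_int (a i))))" for c
  define \<chi> where "\<chi> c h = (\<Prod>i\<in>I. cis (pi * of_int (c i * h i) / of_int (a i)))" for c h
  have finbox: "finite box" unfolding box_def using fin by (intro finite_PiE) auto
  have red_box: "red c \<in> box" for c
    using nz by (auto simp: red_def box_def PiE_def)
  have red_dvd: "2 * a i dvd red c i - c i" if "i \<in> I" for c i
  proof -
    have "2 * \<bar>a i\<bar> dvd c i mod (2 * \<bar>a i\<bar>) - c i"
      by (simp add: mod_eq_dvd_iff[symmetric])
    then show ?thesis using that by (simp add: red_def abs_if split: if_splits)
  qed
  have red_eqI: "red c = d" if "d \<in> box" "\<And>i. i \<in> I \<Longrightarrow> 2 * a i dvd c i - d i" for c d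
  proof
    fix i
    show "red c i = d i"
    proof (cases "i \<in> I")
      case True
      then have "2 * \<bar>a i\<bar> dvd c i - d i" using that(2)[of i] by (simp add: abs_if)
      then have "c i mod (2 * \<bar>a i\<bar>) = d i mod (2 * \<bar>a i\<bar>)" by (simp add: mod_eq_dvd_iff)
      also have "\<dots> = d i" using that(1) True by (auto simp: box_def PiE_def Pi_def)
      finally show ?thesis using True by (simp add: red_def)
    next
      case False
      then show ?thesis using that(1) by (auto simp: red_def box_def PiE_def extensional_def)
    qed
  qed
  have shift: "(\<Sum>c\<in>box \<inter> K. F (\<lambda>i. c i + h i)) = (\<Sum>c\<in>box \<inter> K. F c)"
    if h: "h \<in> K" and F: "\<And>c. F (red c) = F c"
      and diffK: "\<And>c d. c \<in> K \<Longrightarrow> d \<in> K \<Longrightarrow> (\<lambda>i. c i - d i) \<in> K"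
      and latK: "\<And>c. (\<And>i. i \<in> I \<Longrightarrow> 2 * a i dvd c i) \<Longrightarrow> c \<in> K"
    for K h and F :: "('i \<Rightarrow> int) \<Rightarrow> complex"
  proof -
    have addK: "(\<lambda>i. c i + d i) \<in> K" if "c \<in> K" "d \<in> K" for c d
      using diffK[OF that(1) diffK[OF latK that(2), of "\<lambda>_. 0"]] by simp
    have redK: "red c \<in> K" if "c \<in> K" for c
      using addK[OF latK that, of "\<lambda>i. red c i - c i"] red_dvd by simp
    show ?thesis
    proof (rule sum.reindex_bij_witness[of _ "\<lambda>c. red (\<lambda>i. c i - h i)" "\<lambda>c. red (\<lambda>i. c i + h i)"])
      fix c assume c: "c \<in> box \<inter> K"
      show "red (\<lambda>i. red (\<lambda>i. c i + h i) i - h i) = c"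
      proof (rule red_eqI)
        show "2 * a i dvd red (\<lambda>i. c i + h i) i - h i - c i" if "i \<in> I" for i
          using red_dvd[OF that, of "\<lambda>i. c i + h i"] by (simp add: algebra_simps)
      qed (use c in simp)
      show "red (\<lambda>i. red (\<lambda>i. c i - h i) i + h i) = c"
      proof (rule red_eqI)
        show "2 * a i dvd red (\<lambda>i. c i - h i) i + h i - c i" if "i \<in> I" for i
          using red_dvd[OF that, of "\<lambda>i. c i - h i"] by (simp add: algebra_simps)
      qed (use c in simp)
      show "red (\<lambda>i. c i + h i) \<in> box \<inter> K" "red (\<lambda>i. c i - h i) \<in> box \<inter> K"
        using c h red_box redK addK diffK by auto
      show "F (red (\<lambda>i. c i + h i)) = F (\<lambda>i. c i + h i)" by (rule F)
    qed
  qed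
  have Q_red: "Q (red c) = Q c" for c
    unfolding Q_def by (intro prod.cong refl cis_square_periodic nz red_dvd)
  have \<chi>_red: "\<chi> c (red h) = \<chi> c h" for c h
    unfolding \<chi>_def by (intro prod.cong refl cis_product_periodic nz red_dvd)
  have Q_add: "Q (\<lambda>i. c i + h i) = Q c * Q h * \<chi> c h" for c h
    unfolding Q_def \<chi>_def prod.distrib[symmetric] cis_mult
    by (intro prod.cong refl arg_cong[where f = cis])
      (use nz in \<open>simp add: field_simps power2_eq_square\<close>)
  have \<chi>_add: "\<chi> c (\<lambda>i. h i + k i) = \<chi> c h * \<chi> c k" for c h k
    unfolding \<chi>_def prod.distrib[symmetric] cis_mult
    by (intro prod.cong refl arg_cong[where f = cis])
      (use nz in \<open>simp add: field_simps\<close>)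
  have Q_H: "Q h = 1" if "h \<in> H" for h
  proof -
    have "Q h = cis (2 * pi * (\<Sum>i\<in>I. of_int (h i) ^ 2 / (4 * of_int (a i))))"
      unfolding Q_def prod_cis sum_distrib_left by (simp add: mult_ac)
    then show ?thesis using isotropic[OF that] by (simp only: cis_2pi_eq_1_iff)
  qed
  have \<chi>_eq: "\<chi> c h = cis (2 * pi * (\<Sum>i\<in>I. of_int (c i * h i) / (2 * of_int (a i))))" for c h
    unfolding \<chi>_def prod_cis sum_distrib_left by (simp add: mult_ac)
  have add: "(\<lambda>i. c i + d i) \<in> H" if "c \<in> H" "d \<in> H" for c d
    using diff[OF that(1) diff[OF lattice that(2), of "\<lambda>_. 0"]] by simp
  have \<chi>_HH: "\<chi> c h = 1" if "c \<in> H" "h \<in> H" for c h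
    using Q_add[of c h] Q_H that add by simp
  have sum_\<chi>: "(\<Sum>h\<in>box \<inter> H. \<chi> c h) = (if c \<in> H then of_nat (card (box \<inter> H)) else 0)" for c
  proof (cases "c \<in> H")
    case False
    then obtain k where k: "k \<in> H" "\<chi> c k \<noteq> 1"
      using self_dual[of c] by (auto simp: \<chi>_eq cis_2pi_eq_1_iff)
    have "(\<Sum>h\<in>box \<inter> H. \<chi> c h) = (\<Sum>h\<in>box \<inter> H. \<chi> c (\<lambda>i. h i + k i))"
      by (rule shift[symmetric]) (use k \<chi>_red diff lattice in auto)
    also have "\<dots> = (\<Sum>h\<in>box \<inter> H. \<chi> c h) * \<chi> c k"
      by (simp add: \<chi>_add sum_distrib_right)
    finally have "(\<Sum>h\<in>box \<inter> H. \<chi> c h) * (\<chi> c k - 1) = 0" by (simp add: algebra_simps)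
    then show ?thesis using k False by simp
  qed (simp add: \<chi>_HH)
  have "(\<lambda>i\<in>I. 0) \<in> box \<inter> H"
    using nz lattice[of "\<lambda>i\<in>I. 0"] by (auto simp: box_def)
  then have card: "card (box \<inter> H) > 0" using finbox by (auto simp: card_gt_0_iff)
  have "of_nat (card (box \<inter> H)) * sum Q box = (\<Sum>h\<in>box \<inter> H. sum Q (box \<inter> UNIV))"
    by simp
  also have "\<dots> = (\<Sum>h\<in>box \<inter> H. \<Sum>c\<in>box \<inter> UNIV. Q (\<lambda>i. c i + h i))"
    by (intro sum.cong refl shift[symmetric] Q_red) auto
  also have "\<dots> = (\<Sum>c\<in>box. Q c * (\<Sum>h\<in>box \<inter> H. \<chi> c h))"
    by (subst sum.swap) (simp add: Q_add Q_H sum_distrib_left)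
  also have "\<dots> = (\<Sum>c\<in>box. if c \<in> H then of_nat (card (box \<inter> H)) else 0)"
    by (rule sum.cong) (auto simp: sum_\<chi> Q_H)
  also have "\<dots> = of_nat (card (box \<inter> H)) * of_nat (card (box \<inter> H))"
    using finbox by (simp add: sum.If_cases)
  finally have "sum Q box = of_nat (card (box \<inter> H))" using card by simp
  moreover have "(\<Prod>i\<in>I. \<Sum>x=0..<2 * \<bar>a i\<bar>. cis (pi * of_int x ^ 2 / (2 * of_int (a i)))) = sum Q box"
    unfolding Q_def box_def using fin by (intro prod_sum_PiE) auto
  ultimately show ?thesis using card by metis
qed

section \<open>Cyclotomic polynomials modulo the sixtieth one\<close>

lemma finite_primitive_roots_of_unity: "n > 0 \<Longrightarrow> finite (primitive_roots_of_unity n)"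
  by (rule finite_subset[OF _ finite_roots_unity[of n]])
    (auto simp: primitive_roots_of_unity_def)

lemma primitive_roots_of_unity_disjoint:
  assumes "d > 0" "e > 0" "d \<noteq> e"
  shows "primitive_roots_of_unity d \<inter> primitive_roots_of_unity e = {}"
  using assms by (cases d e rule: linorder_cases) (auto simp: primitive_roots_of_unity_def)

text \<open>
  Both sides, summed over the divisors of \<open>n\<close>, give \<open>n\<close>.
\<close>

lemma card_primitive_roots_of_unity:
  assumes "n > 0"
  shows "card (primitive_roots_of_unity n) = totient n"
  using assms
proof (induction n rule: less_induct)
  case (less n)
  let ?D = "{d. d dvd n}"
  have fin: "finite ?D" using less.prems by simp
  have pos: "d > 0" if "d dvd n" for d using that less.prems by (auto intro: Nat.gr0I)
  have "n = card {z::complex. z ^ n = 1}"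
    using card_roots_unity_eq[of n] less.prems by simp
  also have "\<dots> = (\<Sum>d\<in>?D. card (primitive_roots_of_unity d))"
    unfolding roots_of_unity_partition[OF less.prems]
    by (rule card_UN_disjoint)
      (use fin pos finite_primitive_roots_of_unity primitive_roots_of_unity_disjoint in auto)
  also have "\<dots> = card (primitive_roots_of_unity n) +
      (\<Sum>d\<in>?D - {n}. card (primitive_roots_of_unity d))"
    using fin by (subst sum.remove[of _ n]) auto
  also have "(\<Sum>d\<in>?D - {n}. card (primitive_roots_of_unity d)) = (\<Sum>d\<in>?D - {n}. totient d)"
  proof (rule sum.cong)
    fix d assume "d \<in> ?D - {n}"
    then have "d < n" "0 < d" using pos dvd_imp_le[of d n] less.prems by auto
    then show "card (primitive_roots_of_unity d) = totient d" by (rule less.IH)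
  qed simp
  finally have "n = card (primitive_roots_of_unity n) + (\<Sum>d\<in>?D - {n}. totient d)" .
  moreover have "n = totient n + (\<Sum>d\<in>?D - {n}. totient d)"
    using totient_divisor_sum[of n] fin by (subst (asm) sum.remove[of _ n]) auto
  ultimately show ?case by linarith
qed

lemma degree_cyclotomic:
  assumes "n > 0"
  shows "degree (cyclotomic n) = totient n"
proof -
  have "degree (cyclotomic n) = degree (of_int_poly (cyclotomic n) :: complex poly)" by simp
  also have "\<dots> = totient n"
    unfolding of_int_poly_cyclotomic[OF assms]
    by (subst degree_prod_eq_sum_degree) (auto simp: card_primitive_roots_of_unity[OF assms])
  finally show ?thesis .
qed

lemma prod_cyclotomic_divisors:
  assumes "n > 0"
  shows "(\<Prod>d | d dvd n. cyclotomic d) = monom 1 n - 1"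
proof -
  let ?h = "of_int_poly :: int poly \<Rightarrow> complex poly"
  have pos: "d > 0" if "d dvd n" for d using that assms by (auto intro: Nat.gr0I)
  have "?h (\<Prod>d | d dvd n. cyclotomic d) = (\<Prod>d | d dvd n. \<Prod>z\<in>primitive_roots_of_unity d. [:- z, 1:])"
    unfolding of_int_poly_hom.hom_prod using pos by (intro prod.cong of_int_poly_cyclotomic) auto
  also have "\<dots> = monom 1 n - 1"
    unfolding roots_of_unity_poly[OF assms, symmetric] roots_of_unity_partition[OF assms]
    by (rule prod.UNION_disjoint[symmetric])
      (use assms pos finite_primitive_roots_of_unity primitive_roots_of_unity_disjoint in auto)
  also have "\<dots> = ?h (monom 1 n - 1)"
    by (simp add: of_int_poly_hom.hom_minus map_poly_monom)
  finally show ?thesis by (rule of_int_poly_hom.injectivity)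
qed

lemma cyclotomic_dvd: "n > 0 \<Longrightarrow> cyclotomic n dvd monom 1 n - 1"
  unfolding prod_cyclotomic_divisors[symmetric] by (rule dvd_prodI) auto

lemma cyclotomic_eqI:
  assumes n: "n > 0" and monic: "lead_coeff p = 1" and deg: "degree p = totient n"
    and roots: "\<And>z. z \<in> primitive_roots_of_unity n \<Longrightarrow> poly (of_int_poly p) z = 0"
  shows "cyclotomic n = p"
proof -
  let ?F = "of_int_poly (cyclotomic n) :: complex poly" and ?p = "of_int_poly p :: complex poly"
  have F: "?F = (\<Prod>z\<in>primitive_roots_of_unity n. [:- z, 1:])" by (rule of_int_poly_cyclotomic[OF n])
  have fin: "finite (primitive_roots_of_unity n)" by (rule finite_primitive_roots_of_unity[OF n])
  have "lead_coeff ?F = 1" unfolding F by (simp add: lead_coeff_prod)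
  then have lc: "coeff ?F (totient n) = 1" "coeff ?p (totient n) = 1"
    using degree_cyclotomic[OF n] deg monic by auto
  have dF: "degree ?F \<le> totient n" "degree ?p \<le> totient n"
    using degree_cyclotomic[OF n] deg by auto
  have "degree (?F - ?p) < totient n" if "?F - ?p \<noteq> 0"
  proof (rule ccontr)
    assume "\<not> degree (?F - ?p) < totient n"
    then have "degree (?F - ?p) = totient n" using degree_diff_le[OF dF] by simp
    then have "lead_coeff (?F - ?p) = coeff ?F (totient n) - coeff ?p (totient n)"
      by (simp only: coeff_diff)
    then show False using that lc by (simp only: leading_coeff_0_iff diff_self)
  qed
  moreover have "totient n \<le> degree (?F - ?p)" if "?F - ?p \<noteq> 0"
  proof -
    have "primitive_roots_of_unity n \<subseteq> {z. poly (?F - ?p) z = 0}"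
      using roots fin by (auto simp: F poly_prod)
    then have "card (primitive_roots_of_unity n) \<le> card {z. poly (?F - ?p) z = 0}"
      using that by (intro card_mono poly_roots_finite)
    also have "\<dots> \<le> degree (?F - ?p)" by (rule card_poly_roots_bound[OF that])
    finally show ?thesis by (simp add: card_primitive_roots_of_unity[OF n])
  qed
  ultimately have "?F - ?p = 0" by (meson not_less)
  then have "?F = ?p" by simp
  then show ?thesis by (rule of_int_poly_hom.injectivity)
qed

lemma totient_values:
  "totient 12 = 4" "totient 15 = 8" "totient 20 = 8" "totient 24 = 8" "totient 36 = 12" "totient 60 = 16"
  by code_simp+

lemma cyclotomic_12: "cyclotomic 12 = [:1, 0, -1, 0, 1:]"
proof (rule cyclotomic_eqI)
  fix z assume "z \<in> primitive_roots_of_unity 12"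
  then have z: "z ^ 12 = 1" "z ^ 6 \<noteq> 1" "z ^ 4 \<noteq> 1" by (auto simp: primitive_roots_of_unity_def)
  have "(z ^ 6 - 1) * (z ^ 6 + 1) = z ^ 12 - 1" by (simp add: algebra_simps flip: power_add)
  then have "(z ^ 6 - 1) * (z ^ 6 + 1) = 0" using z(1) by simp
  then have "z ^ 6 + 1 = 0" using z(2) by simp
  moreover have "z ^ 6 + 1 = (z ^ 2 + 1) * (z ^ 4 - z ^ 2 + 1)"
    by (simp add: algebra_simps flip: power_add)
  moreover have "z ^ 2 + 1 \<noteq> 0"
  proof
    assume "z ^ 2 + 1 = 0"
    moreover have "z ^ 4 - 1 = (z ^ 2 - 1) * (z ^ 2 + 1)"
      by (simp add: algebra_simps flip: power_add)
    ultimately have "z ^ 4 = 1" by simp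
    then show False using z(3) by simp
  qed
  ultimately have "z ^ 4 - z ^ 2 + 1 = 0" by simp
  then show "poly (of_int_poly [:1, 0, -1, 0, 1:]) z = 0"
    by (simp add: algebra_simps power_numeral_reduce)
qed (simp_all add: totient_values)

lemma cyclotomic_60: "cyclotomic 60 = [:1, 0, 1, 0, 0, 0, -1, 0, -1, 0, -1, 0, 0, 0, 1, 0, 1:]"
  (is "_ = ?C")
proof (rule cyclotomic_eqI)
  fix z assume "z \<in> primitive_roots_of_unity 60"
  then have z: "z ^ 60 = 1" "z ^ 30 \<noteq> 1" "z ^ 20 \<noteq> 1" "z ^ 12 \<noteq> 1"
    by (auto simp: primitive_roots_of_unity_def)
  have "(z ^ 30 - 1) * (z ^ 30 + 1) = z ^ 60 - 1" by (simp add: algebra_simps flip: power_add)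
  then have "(z ^ 30 - 1) * (z ^ 30 + 1) = 0" using z(1) by simp
  then have "z ^ 30 + 1 = 0" using z(2) by simp
  moreover have "z ^ 30 + 1 = (z ^ 10 + 1) * (z ^ 20 - z ^ 10 + 1)"
    by (simp add: algebra_simps flip: power_add)
  moreover have "z ^ 10 + 1 \<noteq> 0"
  proof
    assume "z ^ 10 + 1 = 0"
    moreover have "z ^ 20 - 1 = (z ^ 10 - 1) * (z ^ 10 + 1)"
      by (simp add: algebra_simps flip: power_add)
    ultimately have "z ^ 20 = 1" by simp
    then show False using z(3) by simp
  qed
  ultimately have 1: "z ^ 20 - z ^ 10 + 1 = 0" by simp
  have "z ^ 4 - z ^ 2 + 1 \<noteq> 0"
  proof
    assume "z ^ 4 - z ^ 2 + 1 = 0"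
    moreover have "z ^ 12 - 1 = (z ^ 4 - z ^ 2 + 1) * ((z ^ 2 + 1) * (z ^ 6 - 1))"
      by (simp add: algebra_simps flip: power_add)
    ultimately have "z ^ 12 = 1" by simp
    then show False using z(4) by simp
  qed
  moreover have "z ^ 20 - z ^ 10 + 1 = (z ^ 4 - z ^ 2 + 1) *
      (1 + z ^ 2 - z ^ 6 - z ^ 8 - z ^ 10 + z ^ 14 + z ^ 16)"
    by (simp add: algebra_simps flip: power_add)
  ultimately have "1 + z ^ 2 - z ^ 6 - z ^ 8 - z ^ 10 + z ^ 14 + z ^ 16 = 0" using 1 by simp
  then show "poly (of_int_poly ?C) z = 0"
    by (simp add: algebra_simps power_numeral_reduce)
qed (simp_all add: totient_values)

definition unit_mod :: "int poly \<Rightarrow> int poly \<Rightarrow> bool" where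
  "unit_mod C p \<longleftrightarrow> (\<exists>u. C dvd p * u - 1)"

lemma unit_mod_1 [simp]: "unit_mod C 1"
  unfolding unit_mod_def by (rule exI[of _ 1]) simp

lemma unit_mod_mult:
  assumes "unit_mod C p" "unit_mod C r"
  shows "unit_mod C (p * r)"
proof -
  obtain u v where "C dvd p * u - 1" "C dvd r * v - 1"
    using assms by (auto simp: unit_mod_def)
  then have "C dvd (p * u - 1) * (r * v) + (r * v - 1)" by (intro dvd_add dvd_mult2)
  also have "(p * u - 1) * (r * v) + (r * v - 1) = (p * r) * (u * v) - 1" by (simp add: algebra_simps)
  finally show ?thesis unfolding unit_mod_def by blast
qed

lemma unit_mod_dvd:
  assumes "unit_mod C r" "p dvd r"
  shows "unit_mod C p"
  using assms unfolding unit_mod_def by (metis dvdE mult.assoc)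

lemma unit_mod_cong:
  assumes "unit_mod C p" "C dvd r - p"
  shows "unit_mod C r"
proof -
  obtain u where "C dvd p * u - 1" using assms by (auto simp: unit_mod_def)
  then have "C dvd (r - p) * u + (p * u - 1)" using assms by (intro dvd_add dvd_mult2)
  also have "(r - p) * u + (p * u - 1) = r * u - 1" by (simp add: algebra_simps)
  finally show ?thesis unfolding unit_mod_def by blast
qed

text \<open>
  If \<open>z\<close> is a primitive 60th root of unity, then \<open>z ^ 10\<close>, \<open>z ^ 6\<close> and \<open>z ^ 4\<close> are primitive roots of
  unity of the orders \<open>n = 6, 10, 15\<close>. As \<open>n\<close> is not a prime power, \<open>\<Phi>\<^sub>n(1) = 1\<close>, and
  \<open>1 - \<Phi>\<^sub>n(y)\<close> is a multiple \<open>(y - 1) h(y)\<close>. The witnesses are \<open>h(x ^ e)\<close> and the quotients of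
  \<open>- \<Phi>\<^sub>n(x ^ e)\<close> by \<open>\<Phi>\<^sub>6\<^sub>0\<close>, for \<open>e = 10, 6, 4\<close>.
\<close>

lemma unit_mod_power_minus_1:
  "unit_mod (cyclotomic 60) (monom 1 4 - 1)"
  "unit_mod (cyclotomic 60) (monom 1 6 - 1)"
  "unit_mod (cyclotomic 60) (monom 1 10 - 1)"
proof -
  have 4: "monom 1 4 - 1 = ([:-1, 0, 0, 0, 1:] :: int poly)"
    and 6: "monom 1 6 - 1 = ([:-1, 0, 0, 0, 0, 0, 1:] :: int poly)"
    and 10: "monom 1 10 - 1 = ([:-1, 0, 0, 0, 0, 0, 0, 0, 0, 0, 1:] :: int poly)"
    by (simp_all add: monom_altdef power_numeral_reduce one_pCons)
  have "[:-1, 0, 0, 0, 1:] * [:0, 0, 0, 0, -1, 0, 0, 0, -1, 0, 0, 0, 0, 0, 0, 0, -1, 0, 0, 0, 0, 0, 0, 0, 0, 0, 0, 0, -1:] - 1 = cyclotomic 60 * [:-1, 0, 1, 0, 0, 0, -1, 0, 1, 0, -1, 0, 0, 0, 1, 0, -1:]"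
    unfolding cyclotomic_60 by (simp add: one_pCons)
  then show "unit_mod (cyclotomic 60) (monom 1 4 - 1)" unfolding unit_mod_def 4 by (metis dvd_triv_left)
  have "[:-1, 0, 0, 0, 0, 0, 1:] * [:0, 0, 0, 0, 0, 0, -1, 0, 0, 0, 0, 0, 0, 0, 0, 0, 0, 0, -1:] - 1 = cyclotomic 60 * [:-1, 0, 1, 0, -1, 0, 1, 0, -1:]"
    unfolding cyclotomic_60 by (simp add: one_pCons)
  then show "unit_mod (cyclotomic 60) (monom 1 6 - 1)" unfolding unit_mod_def 6 by (metis dvd_triv_left)
  have "[:-1, 0, 0, 0, 0, 0, 0, 0, 0, 0, 1:] * [:0, 0, 0, 0, 0, 0, 0, 0, 0, 0, -1:] - 1 = cyclotomic 60 * [:-1, 0, 1, 0, -1:]"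
    unfolding cyclotomic_60 by (simp add: one_pCons)
  then show "unit_mod (cyclotomic 60) (monom 1 10 - 1)" unfolding unit_mod_def 10 by (metis dvd_triv_left)
qed

lemma monom_minus_1_dvd: "monom 1 m - 1 dvd monom 1 (m * k) - (1 :: int poly)"
proof -
  have "(monom 1 (m * k) :: int poly) = (monom 1 m) ^ k"
    by (simp add: monom_power)
  then show ?thesis by (simp only: power_diff_1_eq dvd_triv_left)
qed

lemma divisors_of_60:
  fixes g :: nat
  assumes "g dvd 60" "\<not> 12 dvd g" "\<not> 15 dvd g" "\<not> 20 dvd g"
  shows "g dvd 4 \<or> g dvd 6 \<or> g dvd 10"
proof (cases "g < 2")
  case True
  then have "g = 0 \<or> g = 1" by auto
  then show ?thesis using assms(1) by auto
next
  case False
  have "\<forall>g\<in>set [2..<61]. g dvd 60 \<longrightarrow> \<not> 12 dvd g \<longrightarrow> \<not> 15 dvd g \<longrightarrow> \<not> 20 dvd g \<longrightarrow>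
      g dvd 4 \<or> g dvd 6 \<or> g dvd (10::nat)" by simp
  moreover have "g \<in> set [2..<61]" using dvd_imp_le[OF assms(1)] False by (simp only: set_upt) simp
  ultimately show ?thesis using assms by blast
qed

text \<open>
  Since \<open>\<Phi>\<^sub>m\<close> divides \<open>x ^ m - 1\<close>, it suffices that some multiple of \<open>m\<close> is congruent modulo 60 to
  4, 6 or 10, as \<open>x ^ 60 = 1\<close> modulo \<open>\<Phi>\<^sub>6\<^sub>0\<close>. This fails only if \<open>m\<close> is divisible by 12, 15 or 20, and among
  these numbers 12 is the only one with totient at most 6.
\<close>

lemma unit_mod_cyclotomic:
  assumes m: "m > 0" and "totient m \<le> 6" "m \<noteq> 12"
  shows "unit_mod (cyclotomic 60) (cyclotomic m)"
proof -
  have small: "\<not> d dvd m" if "totient d \<ge> 7" for d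
    using totient_dvd_mono[of d m] that assms by auto
  have "\<not> 12 dvd m"
  proof
    assume "12 dvd m"
    then obtain j where j: "m = 12 * j" by (elim dvdE)
    have "\<not> 2 dvd j"
    proof
      assume "2 dvd j"
      then have "24 dvd m" unfolding j by (elim dvdE) simp
      then show False using small[of 24] totient_values by simp
    qed
    moreover have "\<not> 3 dvd j"
    proof
      assume "3 dvd j"
      then have "36 dvd m" unfolding j by (elim dvdE) simp
      then show False using small[of 36] totient_values by simp
    qed
    ultimately have "coprime 2 j" "coprime 3 j"
      by (auto intro!: prime_imp_coprime)
    then have "coprime (2 * 2 * 3) j" by (simp only: coprime_mult_left_iff)
    then have "totient m = 4 * totient j"
      unfolding j using totient_mult_coprime[of 12 j] by (simp add: totient_values)
    moreover have "j > 2" using assms(3) j \<open>\<not> 2 dvd j\<close> m by (cases "j = 0"; cases "j = 1"; cases "j = 2") auto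
    then have "totient j > 1" by (rule totient_gt_1)
    ultimately show False using assms(2) by simp
  qed
  moreover have "\<not> 15 dvd m" "\<not> 20 dvd m"
    using small[of 15] small[of 20] totient_values by auto
  ultimately have "gcd m 60 dvd 4 \<or> gcd m 60 dvd 6 \<or> gcd m 60 dvd 10"
    by (intro divisors_of_60) (auto intro: dvd_trans)
  then obtain e where e: "gcd m 60 dvd e" "unit_mod (cyclotomic 60) (monom 1 e - 1)"
    using unit_mod_power_minus_1 by blast
  obtain x y where xy: "m * x = 60 * y + gcd m 60"
    using bezout_nat[of m 60] m by auto
  obtain k where k: "e = gcd m 60 * k" using e(1) by (elim dvdE)
  have "m * (x * k) = (60 * y + gcd m 60) * k" unfolding xy[symmetric] by simp
  also have "\<dots> = 60 * (y * k) + e" by (simp add: k algebra_simps)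
  finally have mx: "m * (x * k) = 60 * (y * k) + e" .
  have "cyclotomic 60 dvd monom 1 (60 * (y * k)) - 1"
    by (rule dvd_trans[OF cyclotomic_dvd monom_minus_1_dvd]) simp
  then have "cyclotomic 60 dvd monom 1 e * (monom 1 (60 * (y * k)) - 1)" by (rule dvd_mult)
  also have "\<dots> = (monom 1 (m * (x * k)) - 1) - (monom 1 e - 1)"
    unfolding mx by (simp add: algebra_simps mult_monom add.commute)
  finally have "unit_mod (cyclotomic 60) (monom 1 (m * (x * k)) - 1)"
    by (rule unit_mod_cong[OF e(2)])
  then show ?thesis
    by (rule unit_mod_dvd) (rule dvd_trans[OF cyclotomic_dvd[OF m] monom_minus_1_dvd])
qed

lemma unit_mod_prod_mset:
  "(\<And>m. m \<in># M \<Longrightarrow> unit_mod C (f m)) \<Longrightarrow> unit_mod C (prod_mset (image_mset f M))"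
  by (induction M) (auto intro: unit_mod_mult)

lemma cyclotomic_nonzero: "n > 0 \<Longrightarrow> cyclotomic n \<noteq> 0"
  using degree_cyclotomic[of n] by (auto simp: totient_0_iff)

lemma degree_prod_cyclotomic:
  "0 \<notin># M \<Longrightarrow> degree (prod_mset (image_mset cyclotomic M)) = sum_mset (image_mset totient M)"
proof (induction M)
  case (add m M)
  have "cyclotomic k \<noteq> 0" if "k \<in># M" for k
    using that add.prems by (cases "k = 0") (auto simp: cyclotomic_nonzero)
  then have "prod_mset (image_mset cyclotomic M) \<noteq> 0"
    by (auto simp: prod_mset_zero_iff)
  then show ?case using add by (simp add: degree_mult_eq cyclotomic_nonzero degree_cyclotomic)
qed simp

text \<open>
  All factors of \<open>C'\<close> other than \<open>\<Phi>\<^sub>1\<^sub>2\<close> are units modulo \<open>\<Phi>\<^sub>6\<^sub>0\<close>, and \<open>\<Phi>\<^sub>1\<^sub>2\<close>, of degree 4, occurs at most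
  once. So \<open>C'\<close> divides \<open>\<Phi>\<^sub>1\<^sub>2\<close> modulo \<open>\<Phi>\<^sub>6\<^sub>0\<close>.
\<close>

lemma cofactor_mod_cyclotomic_60:
  assumes "product_of_cyclotomics C'" "degree C' \<le> 6"
  shows "\<exists>u. cyclotomic 60 dvd C' * u - cyclotomic 12"
proof -
  obtain M where M: "0 \<notin># M" "C' = prod_mset (image_mset cyclotomic M)"
    using assms by (auto simp: product_of_cyclotomics_def)
  have deg: "sum_mset (image_mset totient M) \<le> 6"
    using assms(2) degree_prod_cyclotomic[OF M(1)] M(2) by simp
  have unit: "unit_mod (cyclotomic 60) (prod_mset (image_mset cyclotomic N))"
    if "N \<subseteq># M" "12 \<notin># N" for N
  proof (rule unit_mod_prod_mset)
    fix m assume m: "m \<in># N"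
    then have "m \<in># M" using that by (meson mset_subset_eqD)
    then have "totient m \<le> 6" "m > 0"
      using deg M(1) by (auto simp: multi_member_split intro: gr0I dest!: multi_member_split)
    then show "unit_mod (cyclotomic 60) (cyclotomic m)"
      using m that by (intro unit_mod_cyclotomic) auto
  qed
  show ?thesis
  proof (cases "12 \<in># M")
    case False
    then obtain u where "cyclotomic 60 dvd C' * u - 1"
      using unit[of M] M(2) by (auto simp: unit_mod_def)
    then have "cyclotomic 60 dvd (C' * u - 1) * cyclotomic 12" by (rule dvd_mult2)
    then show ?thesis by (intro exI[of _ "u * cyclotomic 12"]) (simp add: algebra_simps)
  next
    case True
    then obtain N where N: "M = add_mset 12 N" by (auto dest: multi_member_split)
    have "12 \<notin># N"
    proof
      assume "12 \<in># N"
      then obtain N' where "N = add_mset 12 N'" by (auto dest: multi_member_split)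
      then show False using deg N by (simp add: totient_values)
    qed
    then obtain u where "cyclotomic 60 dvd prod_mset (image_mset cyclotomic N) * u - 1"
      using unit[of N] N by (auto simp: unit_mod_def)
    then have "cyclotomic 60 dvd cyclotomic 12 * (prod_mset (image_mset cyclotomic N) * u - 1)"
      by (rule dvd_mult)
    then show ?thesis unfolding M(2) N by (intro exI[of _ u]) (simp add: algebra_simps)
  qed
qed

text \<open>
  Differentiating \<open>\<Phi>\<^sub>6\<^sub>0(x) \<Phi>\<^sub>1\<^sub>2(x) = \<Phi>\<^sub>1\<^sub>2(x ^ 5)\<close> at a primitive 12th root of unity \<open>w\<close> gives
  \<open>\<Phi>\<^sub>6\<^sub>0(w) = - 5 w ^ 8\<close>, so that \<open>\<Phi>\<^sub>1\<^sub>2\<close> divides \<open>5 + x ^ 4 \<Phi>\<^sub>6\<^sub>0\<close>; the witness is the quotient.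
\<close>

lemma five_mod_cyclotomic_60: "\<exists>v. cyclotomic 60 dvd cyclotomic 12 * v - [:5:]"
proof -
  have "cyclotomic 12 * [:5, 0, 5, 0, 1, 0, -3, 0, -4, 0, -2, 0, 1, 0, 2, 0, 1:] - [:5:] = cyclotomic 60 * [:0, 0, 0, 0, 1:]"
    unfolding cyclotomic_12 cyclotomic_60 by simp
  then show ?thesis by (metis dvd_triv_left)
qed

section \<open>Bases, polynomials in an endomorphism, and the Cayley--Hamilton theorem\<close>

text \<open>
  A homogeneous linear system with more unknowns than equations. It is solved by fraction-free
  elimination, because it is applied both over the reals and over the integers.
\<close>

lemma exists_nonzero_solution:
  fixes f :: "'i \<Rightarrow> 'j \<Rightarrow> 'r::idom"
  assumes "finite I" "finite J" "card I < card J"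
  shows "\<exists>v. (\<exists>j\<in>J. v j \<noteq> 0) \<and> (\<forall>i\<in>I. (\<Sum>j\<in>J. f i j * v j) = 0)"
  using assms
proof (induction I arbitrary: f J rule: finite_induct)
  case empty
  then have "J \<noteq> {}" by auto
  then show ?case by (intro exI[of _ "\<lambda>_. 1"]) auto
next
  case (insert i0 I)
  show ?case
  proof (cases "\<forall>j\<in>J. f i0 j = 0")
    case True
    obtain v where "\<exists>j\<in>J. v j \<noteq> 0" "\<forall>i\<in>I. (\<Sum>j\<in>J. f i j * v j) = 0"
      using insert.IH[of J f] insert.prems insert.hyps by auto
    then show ?thesis using True by (intro exI[of _ v]) auto
  next
    case False
    then obtain j0 where j0: "j0 \<in> J" "f i0 j0 \<noteq> 0" by blast
    define J' where "J' = J - {j0}"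
    have J': "finite J'" "card I < card J'" "j0 \<notin> J'" "J = insert j0 J'"
      using insert.prems insert.hyps j0 by (auto simp: J'_def)
    define p where "p = f i0 j0"
    obtain v where v: "\<exists>j\<in>J'. v j \<noteq> 0"
      "\<forall>i\<in>I. (\<Sum>j\<in>J'. (p * f i j - f i j0 * f i0 j) * v j) = 0"
      using insert.IH[OF J'(1,2), of "\<lambda>i j. p * f i j - f i j0 * f i0 j"] by blast
    define w where "w j = (if j = j0 then - (\<Sum>j\<in>J'. f i0 j * v j) else p * v j)" for j
    have w: "(\<Sum>j\<in>J. f i j * w j) = p * (\<Sum>j\<in>J'. f i j * v j) - f i j0 * (\<Sum>j\<in>J'. f i0 j * v j)" for i
    proof -
      have "(\<Sum>j\<in>J'. f i j * w j) = (\<Sum>j\<in>J'. p * (f i j * v j))"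
        using J'(3) by (intro sum.cong) (auto simp: w_def)
      then show ?thesis using J' by (simp add: w_def sum_distrib_left)
    qed
    have "(\<Sum>j\<in>J. f i j * w j) = 0" if "i \<in> insert i0 I" for i
    proof (cases "i = i0")
      case True
      then show ?thesis unfolding w by (simp add: p_def)
    next
      case False
      then have "(\<Sum>j\<in>J'. (p * f i j - f i j0 * f i0 j) * v j) = 0" using v(2) that by blast
      then show ?thesis unfolding w
        by (simp add: left_diff_distrib sum_subtractf sum_distrib_left mult.assoc)
    qed
    moreover have "\<exists>j\<in>J. w j \<noteq> 0"
    proof -
      obtain j where "j \<in> J'" "v j \<noteq> 0" using v(1) by blast
      then show ?thesis using J' j0 by (intro bexI[of _ j]) (auto simp: w_def p_def)
    qed
    ultimately show ?thesis by blast
  qed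
qed

context integral_lattice
begin

definition coord :: "'a list \<Rightarrow> 'a \<Rightarrow> nat \<Rightarrow> int" where
  "coord bs x i = representation (set bs) x (bs ! i)"

context
  fixes bs M
  assumes basis: "ordered_basis bs M"
begin

lemma sum_coord:
  assumes "x \<in> M"
  shows "(\<Sum>i<length bs. coord bs x i *s bs ! i) = x"
proof -
  have "(\<Sum>i<length bs. coord bs x i *s bs ! i) =
      (\<Sum>b\<in>set bs. representation (set bs) x b *s b)"
    unfolding coord_def
    by (rule sum.reindex_bij_betw[OF bij_betw_nth]) (use basis in \<open>auto simp: ordered_basis_def\<close>)
  also have "\<dots> = x"
    using assms basis by (intro sum_representation_eq) (auto simp: ordered_basis_def)
  finally show ?thesis .
qed

lemma coord_add: "x \<in> M \<Longrightarrow> y \<in> M \<Longrightarrow> coord bs (x + y) i = coord bs x i + coord bs y i"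
  using basis by (auto simp: coord_def ordered_basis_def representation_add)

lemma coord_scale: "x \<in> M \<Longrightarrow> coord bs (a *s x) i = a * coord bs x i"
  using basis by (auto simp: coord_def ordered_basis_def representation_scale)

lemma coord_sum:
  assumes "i < length bs"
  shows "coord bs (\<Sum>j<length bs. c j *s bs ! j) i = c i"
proof -
  have ind: "independent (set bs)" and dist: "distinct bs" and span: "span (set bs) = M"
    using basis by (auto simp: ordered_basis_def)
  have mem: "a *s bs ! j \<in> span (set bs)" if "j < length bs" for a j
    using that by (intro span_scale span_base nth_mem)
  have "representation (set bs) (\<Sum>j<length bs. c j *s bs ! j) (bs ! i) =
      (\<Sum>j<length bs. representation (set bs) (c j *s bs ! j) (bs ! i))"
    by (subst representation_sum[OF ind]) (auto intro: mem)
  also have "\<dots> = (\<Sum>j<length bs. if j = i then c i else 0)"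
  proof (rule sum.cong)
    fix j assume j: "j \<in> {..<length bs}"
    have "representation (set bs) (c j *s bs ! j) (bs ! i) = c j * (if bs ! i = bs ! j then 1 else 0)"
      using j ind by (subst representation_scale) (auto intro: span_base simp: representation_basis)
    then show "representation (set bs) (c j *s bs ! j) (bs ! i) = (if j = i then c i else 0)"
      using j assms dist by (auto simp: nth_eq_iff_index_eq)
  qed simp
  finally show ?thesis using assms by (simp add: coord_def)
qed

lemma sum_basis_mem: "(\<Sum>j<length bs. c j *s bs ! j) \<in> M"
proof -
  have "(\<Sum>j<length bs. c j *s bs ! j) \<in> span (set bs)"
    by (intro span_sum span_scale span_base nth_mem) simp
  then show ?thesis using basis by (simp add: ordered_basis_def)
qed

end

lemma poly_endo_0 [simp]: "poly_endo 0 t x = 0"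
  by (simp add: poly_endo_def)

lemma poly_endo_extend:
  assumes "degree p \<le> n"
  shows "poly_endo p t x = (\<Sum>i\<le>n. coeff p i *s (t ^^ i) x)"
  unfolding poly_endo_def using assms
  by (intro sum.mono_neutral_left) (auto simp: coeff_eq_0)

context
  fixes t
  assumes t: "module_hom scale scale t"
begin

lemma poly_endo_pCons [simp]: "poly_endo (pCons a p) t x = a *s x + t (poly_endo p t x)"
proof -
  have "poly_endo (pCons a p) t x = (\<Sum>i\<le>Suc (degree p). coeff (pCons a p) i *s (t ^^ i) x)"
    by (rule poly_endo_extend) (simp add: degree_pCons_le)
  also have "\<dots> = a *s x + (\<Sum>i\<le>degree p. coeff p i *s t ((t ^^ i) x))"
    by (subst sum.atMost_Suc_shift) simp
  also have "(\<Sum>i\<le>degree p. coeff p i *s t ((t ^^ i) x)) = t (poly_endo p t x)"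
    unfolding poly_endo_def by (simp add: module_hom.sum[OF t] module_hom.scale[OF t])
  finally show ?thesis .
qed

lemma poly_endo_add: "poly_endo (p + r) t x = poly_endo p t x + poly_endo r t x"
  by (induction p r rule: poly_induct2)
    (auto simp: module_hom.add[OF t] scale_left_distrib algebra_simps)

lemma poly_endo_smult: "poly_endo (Polynomial.smult a p) t x = a *s poly_endo p t x"
  by (induction p) (auto simp: module_hom.scale[OF t] scale_right_distrib)

lemma poly_endo_diff: "poly_endo (p - r) t x = poly_endo p t x - poly_endo r t x"
  using poly_endo_add[of "p - r" r x] by simp

lemma poly_endo_mult: "poly_endo (p * r) t x = poly_endo p t (poly_endo r t x)"
  by (induction p) (auto simp: poly_endo_add poly_endo_smult)

lemma poly_endo_hom: "module_hom scale scale (poly_endo p t)"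
proof (intro module_hom.intro module_hom_axioms.intro)
  show "Modules.module scale" "Modules.module scale" by (rule module_axioms)+
  show "poly_endo p t (x + y) = poly_endo p t x + poly_endo p t y" for x y
    by (induction p) (auto simp: module_hom.add[OF t] module_hom.zero[OF t] scale_right_distrib algebra_simps)
  show "poly_endo p t (a *s x) = a *s poly_endo p t x" for a x
    by (induction p) (auto simp: module_hom.scale[OF t] module_hom.zero[OF t] scale_right_distrib mult.commute)
qed

lemma poly_endo_sum: "poly_endo (sum p A) t x = (\<Sum>a\<in>A. poly_endo (p a) t x)"
  by (induction A rule: infinite_finite_induct) (auto simp: poly_endo_add)

text \<open>
  The polynomials act on the lattice through \<open>t\<close>. The matrix \<open>N = x I - A\<close>, for this action, annihilates the
  tuple of the basis vectors (column by column, as these are the images under \<open>t\<close>). Multiplying by the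
  adjugate of \<open>N\<close> shows that \<open>det N\<close>, the characteristic polynomial, annihilates each basis vector.
\<close>

lemma cayley_hamilton:
  assumes bs: "ordered_basis bs UNIV"
  shows "poly_endo (char_poly (endo_matrix bs t)) t x = 0"
proof -
  define n where "n = length bs"
  define A where "A = endo_matrix bs t"
  define N where "N = char_poly_matrix A"
  define c where "c = char_poly A"
  have A: "A \<in> carrier_mat n n" by (simp add: A_def n_def endo_matrix_def)
  have N: "N \<in> carrier_mat n n" using A by (simp add: N_def)
  have adj: "adj_mat N \<in> carrier_mat n n" and Nadj: "N * adj_mat N = c \<cdot>\<^sub>m 1\<^sub>m n"
    using adj_mat[OF N] by (auto simp: c_def char_poly_def N_def)
  have Aij: "A $$ (i, j) = coord bs (t (bs ! j)) i" if "i < n" "j < n" for i j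
    using that by (simp add: A_def endo_matrix_def coord_def n_def)
  have col: "(\<Sum>i<n. poly_endo (N $$ (i, j)) t (bs ! i)) = 0" if j: "j < n" for j
  proof -
    have "(\<Sum>i<n. poly_endo (N $$ (i, j)) t (bs ! i)) =
        (\<Sum>i<n. (if i = j then t (bs ! j) else 0) - coord bs (t (bs ! j)) i *s bs ! i)"
    proof (rule sum.cong)
      fix i assume i: "i \<in> {..<n}"
      have "N $$ (i, j) = (if i = j then [:0, 1:] else 0) + [:- A $$ (i, j):]"
        using i j A by (auto simp: N_def char_poly_matrix_def)
      then show "poly_endo (N $$ (i, j)) t (bs ! i) =
          (if i = j then t (bs ! j) else 0) - coord bs (t (bs ! j)) i *s bs ! i"
        using i j by (auto simp: poly_endo_add Aij module_hom.zero[OF t])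
    qed simp
    also have "\<dots> = 0"
      using j sum_coord[OF bs, of "t (bs ! j)"] by (simp add: sum_subtractf n_def)
    finally show ?thesis .
  qed
  have "poly_endo c t (bs ! k) = 0" if k: "k < n" for k
  proof -
    have "poly_endo c t (bs ! k) = (\<Sum>i<n. if i = k then poly_endo c t (bs ! i) else 0)"
      using k by simp
    also have "\<dots> = (\<Sum>i<n. poly_endo ((N * adj_mat N) $$ (i, k)) t (bs ! i))"
      by (rule sum.cong) (use k Nadj in auto)
    also have "\<dots> = (\<Sum>i<n. \<Sum>j<n. poly_endo (adj_mat N $$ (j, k)) t (poly_endo (N $$ (i, j)) t (bs ! i)))"
    proof (rule sum.cong)
      fix i assume "i \<in> {..<n}"
      then have "(N * adj_mat N) $$ (i, k) = (\<Sum>j<n. adj_mat N $$ (j, k) * N $$ (i, j))"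
        using k N adj by (simp add: scalar_prod_def atLeast0LessThan mult.commute)
      then show "poly_endo ((N * adj_mat N) $$ (i, k)) t (bs ! i) =
          (\<Sum>j<n. poly_endo (adj_mat N $$ (j, k)) t (poly_endo (N $$ (i, j)) t (bs ! i)))"
        by (simp add: poly_endo_sum poly_endo_mult)
    qed simp
    also have "\<dots> = (\<Sum>j<n. poly_endo (adj_mat N $$ (j, k)) t (\<Sum>i<n. poly_endo (N $$ (i, j)) t (bs ! i)))"
      by (subst sum.swap) (simp add: module_hom.sum[OF poly_endo_hom])
    also have "\<dots> = 0" using col by (simp add: module_hom.zero[OF poly_endo_hom])
    finally show ?thesis .
  qed
  then have "poly_endo c t (\<Sum>i<n. coord bs x i *s bs ! i) = 0"
    by (simp add: module_hom.sum[OF poly_endo_hom] module_hom.scale[OF poly_endo_hom])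
  then show ?thesis using sum_coord[OF bs, of x] by (simp add: n_def c_def A_def)
qed

end

section \<open>Signatures and orthogonal sets\<close>

lemma q_add_right: "q x (y + z) = q x y + q x z"
  and q_scale_right: "q x (a *s y) = a * q x y"
  and q_sum_right: "q x (sum f A) = (\<Sum>a\<in>A. q x (f a))"
  and q_zero_right [simp]: "q x 0 = 0"
  and q_diff_right: "q x (y - z) = q x y - q x z"
  using module_hom.add[OF linear] module_hom.scale[OF linear] module_hom.sum[OF linear]
    module_hom.zero[OF linear] module_hom.diff[OF linear] by auto

lemma q_add_left: "q (y + z) x = q y x + q z x"
  and q_scale_left: "q (a *s y) x = a * q y x"
  and q_sum_left: "q (sum f A) x = (\<Sum>a\<in>A. q (f a) x)"
  and q_zero_left [simp]: "q 0 x = 0"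
  and q_diff_left: "q (y - z) x = q y x - q z x"
  unfolding sym[of _ x] by (simp_all add: q_add_right q_scale_right q_sum_right q_diff_right)

lemmas q_simps = q_add_right q_scale_right q_diff_right q_add_left q_scale_left q_diff_left

text \<open>
  With \<open>R\<close> the inverse of the base change \<open>P\<close>, the real coordinates \<open>R c\<close> of a vector with integral
  coordinates \<open>c\<close> diagonalize the form.
\<close>

lemma signature_coordinates:
  assumes "has_signature M r s"
  obtains bs and d :: "nat \<Rightarrow> real" and \<rho> :: "'a \<Rightarrow> nat \<Rightarrow> real" where
    "ordered_basis bs M"
    "\<And>x y. x \<in> M \<Longrightarrow> y \<in> M \<Longrightarrow> of_int (q x y) = (\<Sum>i<length bs. d i * \<rho> x i * \<rho> y i)"
    "card {i. i < length bs \<and> d i > 0} = r" "card {i. i < length bs \<and> d i < 0} = s"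
proof -
  obtain bs P where bs: "ordered_basis bs M" and P: "P \<in> carrier_mat (length bs) (length bs)"
    and inv: "invertible_mat P"
    and D: "diagonal_mat (transpose_mat P * map_mat real_of_int (gram_matrix bs) * P)"
      "card {i. i < length bs \<and> (transpose_mat P * map_mat real_of_int (gram_matrix bs) * P) $$ (i, i) > 0} = r"
      "card {i. i < length bs \<and> (transpose_mat P * map_mat real_of_int (gram_matrix bs) * P) $$ (i, i) < 0} = s"
    using assms unfolding has_signature_def Let_def by blast
  define n where "n = length bs"
  define G where "G = map_mat real_of_int (gram_matrix bs)"
  define DD where "DD = transpose_mat P * G * P"
  have G: "G \<in> carrier_mat n n" by (simp add: G_def gram_matrix_def n_def)
  note P = P[folded n_def]
  have DD: "DD \<in> carrier_mat n n" using P G by (simp add: DD_def)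
  obtain R where R: "R \<in> carrier_mat n n" "P * R = 1\<^sub>m n"
  proof -
    obtain R where "inverts_mat P R" "inverts_mat R P" using inv by (auto simp: invertible_mat_def)
    then have "P * R = 1\<^sub>m n" "R * P = 1\<^sub>m (dim_row R)"
      using P by (auto simp: inverts_mat_def)
    then have "dim_col R = n" "dim_row R = n"
      using P by (metis index_mult_mat(3) index_one_mat(3), metis index_mult_mat(3) index_one_mat(3) carrier_matD(2))
    then show thesis using \<open>P * R = 1\<^sub>m n\<close> by (intro that[of R]) auto
  qed
  define c where "c x = vec n (\<lambda>i. real_of_int (coord bs x i))" for x
  have c: "c x \<in> carrier_vec n" for x by (simp add: c_def)
  define \<rho> where "\<rho> x i = (R *\<^sub>v c x) $ i" for x i
  have qc: "of_int (q x y) = c x \<bullet> (G *\<^sub>v c y)" if "x \<in> M" "y \<in> M" for x y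
  proof -
    have "q x y = q (\<Sum>i<n. coord bs x i *s bs ! i) (\<Sum>j<n. coord bs y j *s bs ! j)"
      using that sum_coord[OF bs] by (simp add: n_def)
    also have "\<dots> = (\<Sum>i<n. coord bs x i * (\<Sum>j<n. q (bs ! i) (bs ! j) * coord bs y j))"
      by (simp only: q_sum_left q_scale_left) (simp add: q_sum_right q_scale_right mult.commute)
    finally have "of_int (q x y) = (\<Sum>i<n. real_of_int (coord bs x i) *
        (\<Sum>j<n. real_of_int (q (bs ! i) (bs ! j)) * real_of_int (coord bs y j)))" by simp
    also have "\<dots> = c x \<bullet> (G *\<^sub>v c y)"
      using G by (simp add: scalar_prod_def c_def G_def gram_matrix_def n_def atLeast0LessThan)
    finally show ?thesis .
  qed
  have PRc: "P *\<^sub>v (R *\<^sub>v c x) = c x" for x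
    using P R c by (simp flip: assoc_mult_mat_vec)
  have q\<rho>: "of_int (q x y) = (\<Sum>i<n. DD $$ (i, i) * \<rho> x i * \<rho> y i)" if "x \<in> M" "y \<in> M" for x y
  proof -
    define u where "u = R *\<^sub>v c x"
    define v where "v = R *\<^sub>v c y"
    have u: "u \<in> carrier_vec n" and v: "v \<in> carrier_vec n" using R c by (auto simp: u_def v_def)
    have "of_int (q x y) = (P *\<^sub>v u) \<bullet> (G *\<^sub>v (P *\<^sub>v v))"
      using qc[OF that] by (simp add: PRc u_def v_def)
    also have "\<dots> = (G *\<^sub>v (P *\<^sub>v v)) \<bullet> (P *\<^sub>v u)"
      using P G u v by (intro comm_scalar_prod[of _ n]) auto
    also have "\<dots> = (transpose_mat P *\<^sub>v (G *\<^sub>v (P *\<^sub>v v))) \<bullet> u"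
      by (rule transpose_vec_mult_scalar[symmetric]) (use P G u v in auto)
    also have "\<dots> = u \<bullet> (transpose_mat P *\<^sub>v (G *\<^sub>v (P *\<^sub>v v)))"
      using P G u v by (intro comm_scalar_prod[of _ n]) auto
    also have "\<dots> = u \<bullet> (DD *\<^sub>v v)"
      unfolding DD_def using P G v by (simp add: assoc_mult_mat_vec[of _ n n _ n])
    also have "\<dots> = (\<Sum>i<n. u $ i * (\<Sum>j<n. DD $$ (i, j) * v $ j))"
      using DD u v by (simp add: scalar_prod_def atLeast0LessThan)
    also have "\<dots> = (\<Sum>i<n. u $ i * (\<Sum>j<n. if j = i then DD $$ (i, i) * v $ i else 0))"
      using D(1) DD unfolding DD_def[symmetric] G_def[symmetric]
      by (intro sum.cong refl arg_cong2[where f = times]) (auto simp: diagonal_mat_def)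
    also have "\<dots> = (\<Sum>i<n. DD $$ (i, i) * \<rho> x i * \<rho> y i)"
      by (intro sum.cong) (auto simp: \<rho>_def u_def v_def)
    finally show ?thesis .
  qed
  show thesis
    by (rule that[OF bs, of "\<lambda>i. DD $$ (i, i)" \<rho>])
      (use q\<rho> D(2,3) in \<open>simp_all add: DD_def G_def n_def\<close>)
qed

definition orthogonal_set :: "'a set \<Rightarrow> bool" where
  "orthogonal_set B \<longleftrightarrow> finite B \<and> (\<forall>b\<in>B. \<forall>b'\<in>B. b \<noteq> b' \<longrightarrow> q b b' = 0) \<and> (\<forall>b\<in>B. q b b \<noteq> 0)"

text \<open>
  The sign \<open>\<epsilon>\<close> covers the positive and the negative vectors at once. If there were more vectors of sign
  \<open>\<epsilon>\<close> in \<open>B\<close> than coordinates of that sign, a nontrivial real combination of them would have all these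
  coordinates equal to 0, so that its norm would both have the sign \<open>\<epsilon>\<close> and not have it.
\<close>

lemma sylvester_inequality:
  fixes d :: "nat \<Rightarrow> real" and \<rho> :: "'a \<Rightarrow> nat \<Rightarrow> real" and \<epsilon> :: int
  assumes B: "orthogonal_set B" "B \<subseteq> M"
    and q\<rho>: "\<And>x y. x \<in> M \<Longrightarrow> y \<in> M \<Longrightarrow> of_int (q x y) = (\<Sum>i<n. d i * \<rho> x i * \<rho> y i)"
    and \<epsilon>: "\<epsilon> = 1 \<or> \<epsilon> = -1"
  shows "card {b \<in> B. \<epsilon> * q b b > 0} \<le> card {i. i < n \<and> of_int \<epsilon> * d i > 0}"
proof (rule ccontr)
  define B' where "B' = {b \<in> B. \<epsilon> * q b b > 0}"
  assume "\<not> ?thesis"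
  then have "card {i. i < n \<and> of_int \<epsilon> * d i > 0} < card B'" by (simp add: B'_def)
  moreover have fin: "finite B'" using B by (auto simp: orthogonal_set_def B'_def)
  ultimately obtain v where v: "\<exists>b\<in>B'. v b \<noteq> 0"
    "\<forall>i\<in>{i. i < n \<and> of_int \<epsilon> * d i > 0}. (\<Sum>b\<in>B'. \<rho> b i * v b) = 0"
    using exists_nonzero_solution[of "{i. i < n \<and> of_int \<epsilon> * d i > 0}" B' "\<lambda>i b. \<rho> b i"] by auto
  define y where "y i = (\<Sum>b\<in>B'. \<rho> b i * v b)" for i
  have diag: "(\<Sum>b'\<in>B'. v b * v b' * of_int (q b b')) = v b ^ 2 * of_int (q b b)" if "b \<in> B'" for b
  proof -
    have "(\<Sum>b'\<in>B'. v b * v b' * of_int (q b b')) = (\<Sum>b'\<in>B'. if b' = b then v b ^ 2 * of_int (q b b) else 0)"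
      using B that by (intro sum.cong) (auto simp: orthogonal_set_def B'_def power2_eq_square)
    then show ?thesis using fin that by simp
  qed
  have "(\<Sum>b\<in>B'. v b ^ 2 * of_int (q b b)) = (\<Sum>b\<in>B'. \<Sum>b'\<in>B'. v b * v b' * of_int (q b b'))"
    by (simp add: diag)
  also have "\<dots> = (\<Sum>b\<in>B'. \<Sum>b'\<in>B'. \<Sum>i<n. d i * (\<rho> b i * v b) * (\<rho> b' i * v b'))"
    using B(2) by (intro sum.cong refl) (auto simp: q\<rho> B'_def subset_iff sum_distrib_left mult_ac)
  also have "\<dots> = (\<Sum>b\<in>B'. \<Sum>i<n. \<Sum>b'\<in>B'. d i * (\<rho> b i * v b) * (\<rho> b' i * v b'))"
    by (intro sum.cong refl sum.swap)
  also have "\<dots> = (\<Sum>i<n. \<Sum>b\<in>B'. \<Sum>b'\<in>B'. d i * (\<rho> b i * v b) * (\<rho> b' i * v b'))"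
    by (rule sum.swap)
  also have "\<dots> = (\<Sum>i<n. d i * y i ^ 2)"
  proof (rule sum.cong)
    fix i
    have "y i ^ 2 = (\<Sum>b\<in>B'. \<Sum>b'\<in>B'. (\<rho> b i * v b) * (\<rho> b' i * v b'))"
      unfolding y_def power2_eq_square by (rule sum_product)
    then show "(\<Sum>b\<in>B'. \<Sum>b'\<in>B'. d i * (\<rho> b i * v b) * (\<rho> b' i * v b')) = d i * y i ^ 2"
      by (simp only: sum_distrib_left mult.assoc)
  qed simp
  finally have eq: "of_int \<epsilon> * (\<Sum>b\<in>B'. v b ^ 2 * of_int (q b b)) = of_int \<epsilon> * (\<Sum>i<n. d i * y i ^ 2)" by simp
  have "of_int \<epsilon> * (\<Sum>i<n. d i * y i ^ 2) = (\<Sum>i<n. (of_int \<epsilon> * d i) * y i ^ 2)"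
    by (simp add: sum_distrib_left mult.assoc)
  also have "\<dots> \<le> 0"
  proof (rule sum_nonpos)
    fix i assume "i \<in> {..<n}"
    then show "of_int \<epsilon> * d i * y i ^ 2 \<le> 0"
      using v(2) by (cases "of_int \<epsilon> * d i > 0") (auto simp: y_def mult_nonpos_nonneg)
  qed
  finally have le: "of_int \<epsilon> * (\<Sum>b\<in>B'. v b ^ 2 * of_int (q b b)) \<le> 0" unfolding eq .
  obtain b where b: "b \<in> B'" "v b \<noteq> 0" using v(1) by blast
  have "0 < (\<Sum>b\<in>B'. v b ^ 2 * of_int (\<epsilon> * q b b))"
  proof (rule sum_pos2[OF fin b(1)])
    show "0 < v b ^ 2 * of_int (\<epsilon> * q b b)"
      using b by (intro mult_pos_pos) (auto simp: B'_def simp del: of_int_mult)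
    show "0 \<le> v b ^ 2 * of_int (\<epsilon> * q b b)" if "b \<in> B'" for b
      using that by (intro mult_nonneg_nonneg) (auto simp: B'_def simp del: of_int_mult)
  qed
  also have "\<dots> = of_int \<epsilon> * (\<Sum>b\<in>B'. v b ^ 2 * of_int (q b b))"
    by (simp add: sum_distrib_left mult_ac)
  finally show False using le by simp
qed

lemma orthogonal_projection:
  assumes B: "orthogonal_set B" and b: "b \<in> B"
  shows "q ((\<Prod>b\<in>B. q b b) *s y - (\<Sum>b'\<in>B. (q y b' * ((\<Prod>b\<in>B. q b b) div q b' b')) *s b')) b = 0"
proof -
  define D where "D = (\<Prod>b\<in>B. q b b)"
  have "(\<Sum>b'\<in>B. q y b' * (D div q b' b') * q b' b) =
      (\<Sum>b'\<in>B. if b' = b then q y b * (D div q b b) * q b b else 0)"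
    using B b by (intro sum.cong) (auto simp: orthogonal_set_def)
  also have "\<dots> = q y b * (D div q b b * q b b)"
    using B b by (simp add: orthogonal_set_def mult.assoc)
  also have "D div q b b * q b b = D"
    unfolding D_def using B b by (intro dvd_div_mult_self dvd_prodI) (auto simp: orthogonal_set_def)
  finally show ?thesis unfolding D_def[symmetric]
    by (simp add: q_diff_left q_scale_left q_sum_left mult.commute)
qed

lemma submodule_closed:
  assumes "ordered_basis bs M"
  shows "0 \<in> M" "x \<in> M \<Longrightarrow> y \<in> M \<Longrightarrow> x + y \<in> M" "x \<in> M \<Longrightarrow> y \<in> M \<Longrightarrow> x - y \<in> M"
    "x \<in> M \<Longrightarrow> a *s x \<in> M" "(\<And>i. i \<in> I \<Longrightarrow> f i \<in> M) \<Longrightarrow> sum f I \<in> M"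
proof -
  have M: "M = span (set bs)" using assms by (simp add: ordered_basis_def)
  show "0 \<in> M" "x \<in> M \<Longrightarrow> y \<in> M \<Longrightarrow> x + y \<in> M" "x \<in> M \<Longrightarrow> y \<in> M \<Longrightarrow> x - y \<in> M"
    "x \<in> M \<Longrightarrow> a *s x \<in> M" "(\<And>i. i \<in> I \<Longrightarrow> f i \<in> M) \<Longrightarrow> sum f I \<in> M"
    unfolding M by (auto intro: span_zero span_add span_diff span_scale span_sum)
qed

text \<open>
  For a submodule \<open>M\<close>, completeness means that the set spans \<open>M\<close> over the rationals.
\<close>

definition complete_orthogonal_set :: "'a set \<Rightarrow> 'a set \<Rightarrow> bool" where
  "complete_orthogonal_set M B \<longleftrightarrow> orthogonal_set B \<and> B \<subseteq> M \<and>
     (\<forall>x\<in>M. (\<forall>b\<in>B. q x b = 0) \<longrightarrow> x = 0)"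

text \<open>
  By the law of inertia the number of elements of an orthogonal set in \<open>M\<close> is bounded, so there is a
  largest one. Vectors of \<open>M\<close> orthogonal to it are isotropic, hence orthogonal to one another and, by
  projection, to all of \<open>M\<close>. The rank of \<open>M\<close> is at most the number of elements, by solving the linear
  equations that express orthogonality. As the rank is at least \<open>r + s\<close>, the two bounds from the law of
  inertia are attained.
\<close>

lemma complete_orthogonal_set_of_signature:
  assumes sig: "has_signature M r s"
    and nondeg: "\<And>x. x \<in> M \<Longrightarrow> (\<And>y. y \<in> M \<Longrightarrow> q x y = 0) \<Longrightarrow> x = 0"
  obtains B where "complete_orthogonal_set M B"
    "card {b \<in> B. q b b > 0} = r" "card {b \<in> B. q b b < 0} = s"
    "\<And>bs. ordered_basis bs M \<Longrightarrow> length bs \<le> r + s"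
proof -
  obtain bs0 and d :: "nat \<Rightarrow> real" and \<rho> where bs0: "ordered_basis bs0 M"
    and q\<rho>: "\<And>x y. x \<in> M \<Longrightarrow> y \<in> M \<Longrightarrow> of_int (q x y) = (\<Sum>i<length bs0. d i * \<rho> x i * \<rho> y i)"
    and r: "card {i. i < length bs0 \<and> d i > 0} = r" and s: "card {i. i < length bs0 \<and> d i < 0} = s"
    by (rule signature_coordinates[OF sig]) blast
  note closed = submodule_closed[OF bs0]
  define orth where "orth B \<longleftrightarrow> orthogonal_set B \<and> B \<subseteq> M" for B
  have pos: "card {b \<in> B. q b b > 0} \<le> r" and neg: "card {b \<in> B. q b b < 0} \<le> s" if "orth B" for B
    using sylvester_inequality[where B = B and \<epsilon> = 1, OF _ _ q\<rho>]
      sylvester_inequality[where B = B and \<epsilon> = "-1", OF _ _ q\<rho>] that r s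
    by (auto simp: orth_def)
  have split: "card B = card {b \<in> B. q b b > 0} + card {b \<in> B. q b b < 0}" if "orth B" for B
  proof -
    have "B = {b \<in> B. q b b > 0} \<union> {b \<in> B. q b b < 0}"
      using that by (auto simp: orth_def orthogonal_set_def)
    moreover have "card ({b \<in> B. q b b > 0} \<union> {b \<in> B. q b b < 0}) =
        card {b \<in> B. q b b > 0} + card {b \<in> B. q b b < 0}"
      using that by (intro card_Un_disjoint) (auto simp: orth_def orthogonal_set_def)
    ultimately show ?thesis by simp
  qed
  have "orth {}" by (simp add: orth_def orthogonal_set_def)
  moreover have "\<forall>B. orth B \<longrightarrow> card B < Suc (r + s)"
  proof (intro allI impI)
    fix B assume "orth B"
    from pos[OF this] neg[OF this] split[OF this] show "card B < Suc (r + s)" by linarith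
  qed
  ultimately obtain B where B: "orth B" and max: "\<And>B'. orth B' \<Longrightarrow> card B' \<le> card B"
    using ex_has_greatest_nat[of orth "{}" card "Suc (r + s)"] by blast
  have fin: "finite B" and BM: "B \<subseteq> M" and orthB: "orthogonal_set B"
    using B by (auto simp: orth_def orthogonal_set_def)
  have isotropic: "q x x = 0" if x: "x \<in> M" "\<And>b. b \<in> B \<Longrightarrow> q x b = 0" for x
  proof (rule ccontr)
    assume "q x x \<noteq> 0"
    then have "x \<notin> B" using x(2) by blast
    have "q b x = 0" if "b \<in> B" for b
      using x(2)[OF that] by (simp only: sym[of b x])
    then have "orth (insert x B)"
      using B x \<open>q x x \<noteq> 0\<close> unfolding orth_def orthogonal_set_def by blast
    then show False using max[of "insert x B"] fin \<open>x \<notin> B\<close> by simp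
  qed
  have complete: "x = 0" if x: "x \<in> M" "\<And>b. b \<in> B \<Longrightarrow> q x b = 0" for x
  proof (rule nondeg[OF x(1)])
    fix y assume y: "y \<in> M"
    \<comment> \<open>The vector \<open>y'\<close> is \<open>D\<close> times the component of \<open>y\<close> orthogonal to \<open>B\<close>.\<close>
    define D where "D = (\<Prod>b\<in>B. q b b)"
    define y' where "y' = D *s y - (\<Sum>b\<in>B. (q y b * (D div q b b)) *s b)"
    have y': "y' \<in> M" unfolding y'_def using y BM by (intro closed) auto
    have y'B: "q y' b = 0" if "b \<in> B" for b
      unfolding y'_def D_def by (rule orthogonal_projection[OF orthB that])
    have "q (x + y') (x + y') = 0"
    proof (rule isotropic)
      show "x + y' \<in> M" using x(1) y' by (rule closed(2))
      show "q (x + y') b = 0" if "b \<in> B" for b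
        using x(2)[OF that] y'B[OF that] by (simp add: q_add_left)
    qed
    moreover have "q x x = 0" using x by (rule isotropic)
    moreover have "q y' y' = 0" using y' y'B by (rule isotropic)
    ultimately have "q x y' = 0" by (simp add: q_add_left q_add_right sym[of y' x])
    moreover have "q x y' = D * q x y"
      using x(2) by (simp add: y'_def q_simps q_sum_right)
    moreover have "D \<noteq> 0" using orthB by (auto simp: D_def orthogonal_set_def)
    ultimately show "q x y = 0" by simp
  qed
  have len: "length bs \<le> card B" if bs: "ordered_basis bs M" for bs
  proof (rule ccontr)
    assume "\<not> length bs \<le> card B"
    then obtain v where v: "\<exists>j\<in>{..<length bs}. v j \<noteq> 0"
      "\<forall>b\<in>B. (\<Sum>j<length bs. q (bs ! j) b * v j) = 0"
      using exists_nonzero_solution[of B "{..<length bs}" "\<lambda>b j. q (bs ! j) b"] fin by auto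
    have "(\<Sum>j<length bs. v j *s bs ! j) = 0"
      using v(2) sum_basis_mem[OF bs] by (intro complete) (auto simp: q_sum_left q_scale_left mult.commute)
    then have "v j = 0" if "j < length bs" for j
      using coord_sum[OF bs that, of v] coord_sum[OF bs that, of "\<lambda>_. 0"] by simp
    then show False using v(1) by auto
  qed
  have "r + s = card ({i. i < length bs0 \<and> d i > 0} \<union> {i. i < length bs0 \<and> d i < 0})"
    unfolding r[symmetric] s[symmetric] by (intro card_Un_disjoint[symmetric]) auto
  also have "\<dots> \<le> card {..<length bs0}" by (intro card_mono) auto
  finally have "r + s \<le> card B" using len[OF bs0] by simp
  then have "card {b \<in> B. q b b > 0} = r" "card {b \<in> B. q b b < 0} = s"
    using pos[OF B] neg[OF B] split[OF B] by auto
  moreover have "complete_orthogonal_set M B"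
    using complete orthB BM by (auto simp: complete_orthogonal_set_def)
  moreover have "length bs \<le> r + s" if "ordered_basis bs M" for bs
    using len[OF that] pos[OF B] neg[OF B] split[OF B] by simp
  ultimately show thesis by (intro that)
qed

lemma parseval:
  assumes bs: "ordered_basis bs M" and B: "complete_orthogonal_set M B" and x: "x \<in> M"
  shows "(of_int (q x y) :: real) = (\<Sum>b\<in>B. of_int (q x b * q y b) / of_int (q b b))"
proof -
  define D where "D = (\<Prod>b\<in>B. q b b)"
  define z where "z = (\<Sum>b\<in>B. (q x b * (D div q b b)) *s b)"
  have orthB: "orthogonal_set B" and BM: "B \<subseteq> M" using B by (auto simp: complete_orthogonal_set_def)
  have D: "D \<noteq> 0" using orthB by (auto simp: D_def orthogonal_set_def)
  have "D *s x - z \<in> M" unfolding z_def using x BM by (intro submodule_closed[OF bs]) auto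
  moreover have "q (D *s x - z) b = 0" if "b \<in> B" for b
    unfolding z_def D_def by (rule orthogonal_projection[OF orthB that])
  ultimately have "D *s x - z = 0" using B by (auto simp: complete_orthogonal_set_def)
  then have "D * q x y = q z y" by (metis eq_iff_diff_eq_0 q_scale_left)
  also have "\<dots> = (\<Sum>b\<in>B. q x b * (D div q b b) * q y b)"
    by (simp add: z_def q_sum_left q_scale_left sym[of y])
  finally have "of_int (D * q x y) = (\<Sum>b\<in>B. of_int (q x b * (D div q b b) * q y b) :: real)"
    by (simp only: of_int_sum)
  also have "\<dots> = (\<Sum>b\<in>B. of_int D * (of_int (q x b * q y b) / of_int (q b b)))"
  proof (rule sum.cong)
    fix b assume b: "b \<in> B"
    have "q b b dvd D" unfolding D_def using orthB b by (intro dvd_prodI) (auto simp: orthogonal_set_def)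
    then have "of_int (D div q b b) = (of_int D / of_int (q b b) :: real)" by (rule real_of_int_div)
    then show "of_int (q x b * (D div q b b) * q y b) =
        (of_int D * (of_int (q x b * q y b) / of_int (q b b)) :: real)" by simp
  qed simp
  finally show ?thesis
    using D by (simp only: of_int_mult sum_distrib_left[symmetric] mult_cancel_left of_int_eq_0_iff simp_thms)
qed

section \<open>Unimodular lattices\<close>

lemma poly_endo_commute:
  assumes "module_hom scale scale t"
  shows "poly_endo p t (t x) = t (poly_endo p t x)"
  by (induction p)
    (auto simp: assms module_hom.add[OF assms] module_hom.scale[OF assms] module_hom.zero[OF assms])

text \<open>
  Cramer's rule: the adjugate of the Gram matrix is its inverse, up to sign.
\<close>

lemma unimodular_represents:
  assumes unimodular and \<phi>: "module_hom scale (*) \<phi>"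
  obtains y where "\<And>x. q y x = \<phi> x"
proof -
  obtain bs where bs: "ordered_basis bs UNIV" and det: "det (gram_matrix bs) \<in> {1, -1}"
    using assms(1) by (auto simp: unimodular_def)
  define n where "n = length bs"
  define G where "G = gram_matrix bs"
  have G: "G \<in> carrier_mat n n" by (simp add: G_def n_def gram_matrix_def)
  have adj: "adj_mat G \<in> carrier_mat n n" "G * adj_mat G = det G \<cdot>\<^sub>m 1\<^sub>m n"
    using adj_mat[OF G] by auto
  define c where "c i = det G * (\<Sum>j<n. adj_mat G $$ (i, j) * \<phi> (bs ! j))" for i
  define y where "y = (\<Sum>i<n. c i *s bs ! i)"
  have y: "q y (bs ! k) = \<phi> (bs ! k)" if k: "k < n" for k
  proof -
    have "q y (bs ! k) = (\<Sum>i<n. G $$ (k, i) * c i)"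
      using k by (simp add: y_def q_sum_left q_scale_left G_def gram_matrix_def n_def sym[of "bs ! k"] mult.commute)
    also have "\<dots> = det G * (\<Sum>i<n. \<Sum>j<n. G $$ (k, i) * adj_mat G $$ (i, j) * \<phi> (bs ! j))"
      by (simp add: c_def sum_distrib_left mult_ac)
    also have "\<dots> = det G * (\<Sum>j<n. (\<Sum>i<n. G $$ (k, i) * adj_mat G $$ (i, j)) * \<phi> (bs ! j))"
      by (subst sum.swap) (simp add: sum_distrib_right)
    also have "\<dots> = det G * (\<Sum>j<n. (G * adj_mat G) $$ (k, j) * \<phi> (bs ! j))"
      using G adj(1) k by (simp add: scalar_prod_def atLeast0LessThan)
    also have "\<dots> = det G * (\<Sum>j<n. if j = k then det G * \<phi> (bs ! k) else 0)"
      unfolding adj(2) using k by (intro arg_cong2[where f = times] sum.cong) auto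
    also have "\<dots> = det G * det G * \<phi> (bs ! k)" using k by simp
    also have "det G * det G = 1" using det by (auto simp: G_def)
    finally show ?thesis by simp
  qed
  have "q y x = \<phi> x" for x
  proof -
    have "q y x = q y (\<Sum>i<n. coord bs x i *s bs ! i)" using sum_coord[OF bs] by (simp add: n_def)
    also have "\<dots> = (\<Sum>i<n. coord bs x i * \<phi> (bs ! i))" by (simp add: q_sum_right q_scale_right y)
    also have "\<dots> = \<phi> (\<Sum>i<n. coord bs x i *s bs ! i)"
      by (simp add: module_hom.sum[OF \<phi>] module_hom.scale[OF \<phi>])
    also have "\<dots> = \<phi> x" using sum_coord[OF bs] by (simp add: n_def)
    finally show ?thesis .
  qed
  then show thesis by (rule that)
qed

lemma functionalI:
  assumes "\<And>x y. \<phi> (x + y) = \<phi> x + \<phi> y" "\<And>a x. \<phi> (a *s x) = a * \<phi> x"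
  shows "module_hom scale (*) \<phi>"
proof (intro module_hom.intro module_hom_axioms.intro)
  show "Modules.module scale" by (rule module_axioms)
  show "Modules.module ((*) :: int \<Rightarrow> _)" using linear[of 0] by (simp add: module_hom_def)
qed (fact assms)+

lemma unimodular_nondegenerate:
  assumes unimodular "\<And>y. q x y = 0"
  shows "x = 0"
proof -
  obtain bs where bs: "ordered_basis bs UNIV" using free by blast
  have "coord bs x i = 0" for i
  proof -
    have "module_hom scale (*) (\<lambda>x. coord bs x i)"
      using bs by (intro functionalI) (auto simp: coord_add coord_scale)
    then obtain y where "\<And>x. q y x = coord bs x i" by (rule unimodular_represents[OF assms(1)]) blast
    then show ?thesis using assms(2)[of y] by (simp add: sym)
  qed
  then show ?thesis using sum_coord[OF bs, of x] by simp
qed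

end

lemma module_hom_funpow:
  assumes "module_hom scale scale t"
  shows "module_hom scale scale (t ^^ n)"
proof (induction n)
  case 0
  show ?case using assms by (auto simp: module_hom_def module_hom_axioms_def)
next
  case (Suc n)
  then show ?case using assms by (auto simp: module_hom_def module_hom_axioms_def)
qed

context integral_lattice
begin

text \<open>
  A palindromic polynomial in \<open>t\<close> and the same polynomial in the inverse of \<open>t\<close> differ by a power of \<open>t\<close>.
\<close>

lemma poly_endo_reflect:
  assumes t: "module_hom scale scale t" and "bij t" and p: "reflect_poly p = p"
  shows "(t ^^ degree p) (poly_endo p (inv_into UNIV t) x) = poly_endo p t x"
proof -
  let ?n = "degree p"
  have cancel: "(t ^^ ?n) ((inv_into UNIV t ^^ i) y) = (t ^^ (?n - i)) y" if "i \<le> ?n" for i y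
  proof -
    have "(t ^^ i) ((inv_into UNIV t ^^ i) y) = y" for y
      by (induction i arbitrary: y)
        (simp_all add: funpow_swap1 surj_f_inv_f[OF bij_is_surj[OF \<open>bij t\<close>]])
    then show ?thesis
      using that funpow_add[of "?n - i" i t] by simp
  qed
  have "(t ^^ ?n) (poly_endo p (inv_into UNIV t) x) = (\<Sum>i\<le>?n. coeff p i *s (t ^^ (?n - i)) x)"
    unfolding poly_endo_def
    by (simp add: module_hom.sum[OF module_hom_funpow[OF t]] module_hom.scale[OF module_hom_funpow[OF t]] cancel)
  also have "\<dots> = (\<Sum>i\<le>?n. coeff p (?n - i) *s (t ^^ i) x)"
    by (rule sum.reindex_bij_witness[of _ "\<lambda>i. ?n - i" "\<lambda>i. ?n - i"]) auto
  also have "\<dots> = poly_endo p t x"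
    unfolding poly_endo_def
  proof (rule sum.cong)
    fix i assume "i \<in> {..?n}"
    then have "coeff p (?n - i) = coeff (reflect_poly p) i" by (simp add: coeff_reflect_poly)
    then show "coeff p (?n - i) *s (t ^^ i) x = coeff p i *s (t ^^ i) x" by (simp add: p)
  qed simp
  finally show ?thesis .
qed

lemma poly_endo_cong_mod:
  assumes t: "module_hom scale scale t" and "C dvd p - r" "poly_endo C t x = 0"
  shows "poly_endo p t x = poly_endo r t x"
proof -
  obtain k where "p - r = C * k" using assms(2) by (elim dvdE)
  then have "p = r + k * C" by (simp add: algebra_simps)
  then show ?thesis
    using assms(3) by (simp add: poly_endo_add[OF t] poly_endo_mult[OF t] module_hom.zero[OF poly_endo_hom[OF t]])
qed

end

section \<open>The overlattice of the kernel\<close>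

text \<open>
  The polynomials \<open>u\<close> and \<open>v\<close> are witnesses for \<open>\<Phi>\<^sub>1\<^sub>2 \<in> (C', \<Phi>\<^sub>6\<^sub>0)\<close> and \<open>5 \<in> (\<Phi>\<^sub>1\<^sub>2, \<Phi>\<^sub>6\<^sub>0)\<close>. In particular
  \<open>C' u v = 5\<close> modulo \<open>\<Phi>\<^sub>6\<^sub>0\<close>, so that \<open>(C' u v)(t)\<close> is 5 times the orthogonal projection to the
  kernel of \<open>\<Phi>\<^sub>6\<^sub>0(t)\<close>.
\<close>

locale cyclotomic_60_isometry = integral_lattice scale q
  for scale :: "int \<Rightarrow> 'a::ab_group_add \<Rightarrow> 'a" (infixr \<open>*s\<close> 75) and q :: "'a \<Rightarrow> 'a \<Rightarrow> int" +
  fixes t :: "'a \<Rightarrow> 'a" and C' u v :: "int poly"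
  assumes unimodular: unimodular
    and even_norm: even_lattice
    and isometry: "isometry t"
    and annihilated: "poly_endo (cyclotomic 60 * C') t x = 0"
    and cofactor: "cyclotomic 60 dvd C' * u - cyclotomic 12"
    and five: "cyclotomic 60 dvd cyclotomic 12 * v - [:5:]"
begin

abbreviation "C \<equiv> cyclotomic 60"
abbreviation "s \<equiv> inv_into UNIV t"
abbreviation "M \<equiv> poly_kernel C t"

lemma t_hom: "module_hom scale scale t" and t_bij: "bij t" and q_t: "q (t x) (t y) = q x y"
  using isometry by (auto simp: isometry_def)

lemma t_s [simp]: "t (s x) = x" and s_t [simp]: "s (t x) = x"
  using t_bij by (simp_all add: bij_is_surj bij_is_inj surj_f_inv_f)

lemma t_eq_iff [simp]: "t x = t y \<longleftrightarrow> x = y"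
  using s_t by metis

lemma s_hom: "module_hom scale scale s"
proof (intro module_hom.intro module_hom_axioms.intro)
  show "Modules.module scale" "Modules.module scale" by (rule module_axioms)+
  have "t (s (x + y)) = t (s x + s y)" for x y by (simp add: module_hom.add[OF t_hom])
  then show "s (x + y) = s x + s y" for x y by (simp only: t_eq_iff)
  have "t (s (a *s x)) = t (a *s s x)" for a x by (simp add: module_hom.scale[OF t_hom])
  then show "s (a *s x) = a *s s x" for a x by (simp only: t_eq_iff)
qed

lemmas t_simps = module_hom.add[OF t_hom] module_hom.scale[OF t_hom] module_hom.diff[OF t_hom]
  module_hom.zero[OF t_hom] module_hom.neg[OF t_hom]
lemmas s_simps = module_hom.add[OF s_hom] module_hom.scale[OF s_hom] module_hom.diff[OF s_hom]
  module_hom.zero[OF s_hom]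

lemma q_t_left: "q (t x) y = q x (s y)"
  using q_t[of x "s y"] by simp

lemma q_s_left: "q (s x) y = q x (t y)"
  using q_t[of "s x" y] by simp

lemma adjoint: "q (poly_endo p t x) y = q x (poly_endo p s y)"
proof (induction p arbitrary: y)
  case 0
  show ?case by (simp add:)
next
  case (pCons a p)
  then show ?case
    by (simp add: poly_endo_pCons[OF t_hom] poly_endo_pCons[OF s_hom] q_simps q_t_left
        poly_endo_commute[OF s_hom])
qed

lemma M_iff: "x \<in> M \<longleftrightarrow> poly_endo C t x = 0"
  by (simp add: poly_kernel_def)

lemma M_inverse: "poly_endo C s x = 0" if "x \<in> M"
proof -
  have "reflect_poly C = C" unfolding cyclotomic_60 by (simp add: reflect_poly_def)
  then have "(t ^^ degree C) (poly_endo C s x) = (t ^^ degree C) 0"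
    using that by (simp add: poly_endo_reflect[OF t_hom t_bij] M_iff
        module_hom.zero[OF module_hom_funpow[OF t_hom]])
  moreover have "inj (t ^^ degree C)" using bij_is_inj[OF t_bij] by (rule inj_fn)
  ultimately show ?thesis by (simp only: inj_eq)
qed

lemma M_of_inverse: "x \<in> M" if "poly_endo C s x = 0"
proof -
  have "reflect_poly C = C" unfolding cyclotomic_60 by (simp add: reflect_poly_def)
  then show ?thesis
    using poly_endo_reflect[OF t_hom t_bij, of C x] that
    by (simp add: M_iff module_hom.zero[OF module_hom_funpow[OF t_hom]])
qed

lemma M_zero [simp]: "0 \<in> M"
  and M_add: "x \<in> M \<Longrightarrow> y \<in> M \<Longrightarrow> x + y \<in> M"
  and M_diff: "x \<in> M \<Longrightarrow> y \<in> M \<Longrightarrow> x - y \<in> M"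
  and M_scale: "x \<in> M \<Longrightarrow> a *s x \<in> M"
  using module_hom.add[OF poly_endo_hom[OF t_hom]] module_hom.diff[OF poly_endo_hom[OF t_hom]]
    module_hom.scale[OF poly_endo_hom[OF t_hom]] module_hom.zero[OF poly_endo_hom[OF t_hom]]
  by (auto simp: M_iff)

lemma M_t: "x \<in> M \<Longrightarrow> t x \<in> M"
  using poly_endo_commute[OF t_hom, of C x] by (simp add: M_iff t_simps)

lemma M_s: "x \<in> M \<Longrightarrow> s x \<in> M"
  using poly_endo_commute[OF t_hom, of C "s x"] t_eq_iff[of _ 0] by (simp add: M_iff t_simps)

lemma M_of_scale: "x \<in> M" if "a *s x \<in> M" "a \<noteq> 0"
proof -
  have "a *s poly_endo C t x = 0"
    using that(1) by (simp add: M_iff module_hom.scale[OF poly_endo_hom[OF t_hom]])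
  then have "a * q (poly_endo C t x) y = 0" for y by (simp flip: q_scale_left)
  then have "poly_endo C t x = 0"
    using that(2) by (intro unimodular_nondegenerate[OF unimodular]) simp
  then show ?thesis by (simp add: M_iff)
qed

lemma M_poly: "x \<in> M \<Longrightarrow> poly_endo p t x \<in> M"
  by (induction p) (auto simp: poly_endo_pCons[OF t_hom] intro: M_add M_scale M_t)

lemma cofactor_mem_M: "poly_endo (C' * p) t x \<in> M"
proof -
  have "poly_endo (C * (C' * p)) t x = poly_endo (p * (C * C')) t x" by (simp add: mult_ac)
  also have "\<dots> = 0"
    by (simp add: poly_endo_mult[OF t_hom, of p] annihilated module_hom.zero[OF poly_endo_hom[OF t_hom]])
  finally show ?thesis by (simp add: M_iff poly_endo_mult[OF t_hom, of C])
qed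

lemma cofactor_five: "C dvd C' * (u * v) - [:5:]"
proof -
  have "C dvd (C' * u - cyclotomic 12) * v + (cyclotomic 12 * v - [:5:])"
    using cofactor five by (intro dvd_add dvd_mult2)
  then show ?thesis by (simp add: algebra_simps)
qed

lemma projection_M: "x \<in> M \<Longrightarrow> poly_endo (C' * (u * v)) t x = 5 *s x"
  using poly_endo_cong_mod[OF t_hom cofactor_five, of x]
  by (simp add: M_iff poly_endo_pCons[OF t_hom] t_simps)

lemma M_nondegenerate:
  assumes "x \<in> M" "\<And>y. y \<in> M \<Longrightarrow> q x y = 0"
  shows "x = 0"
proof (rule unimodular_nondegenerate[OF unimodular])
  fix y
  have "5 *s x = poly_endo (C' * (u * v)) s x"
    using poly_endo_cong_mod[OF s_hom cofactor_five, of x] M_inverse[OF assms(1)]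
    by (simp add: poly_endo_pCons[OF s_hom] s_simps)
  then have "5 * q x y = q (poly_endo (C' * (u * v)) s x) y" by (simp flip: q_scale_left)
  also have "\<dots> = q x (poly_endo (C' * (u * v)) t y)"
    using adjoint[of "C' * (u * v)" y x] by (simp add: sym)
  also have "\<dots> = 0" by (rule assms(2)[OF cofactor_mem_M])
  finally show "q x y = 0" by simp
qed

text \<open>
  Composing a functional on \<open>M\<close> with \<open>(C' u v)(t)\<close>, which maps the whole lattice to \<open>M\<close>, gives a functional
  on the whole lattice, represented by some \<open>z\<close> because of unimodularity. It vanishes on the image of
  \<open>\<Phi>\<^sub>6\<^sub>0(t)\<close>, which forces \<open>z \<in> M\<close>; and on \<open>M\<close> it is 5 times the given functional.
\<close>

lemma dual_represented:
  assumes "\<And>x y. x \<in> M \<Longrightarrow> y \<in> M \<Longrightarrow> \<phi> (x + y) = \<phi> x + \<phi> y"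
    and "\<And>a x. x \<in> M \<Longrightarrow> \<phi> (a *s x) = a * \<phi> x"
  obtains z where "z \<in> M" "\<And>x. x \<in> M \<Longrightarrow> q z x = 5 * \<phi> x"
proof -
  let ?R = "C' * (u * v)"
  have "module_hom scale (*) (\<lambda>x. \<phi> (poly_endo ?R t x))"
    by (intro functionalI)
      (simp_all add: module_hom.add[OF poly_endo_hom[OF t_hom]] module_hom.scale[OF poly_endo_hom[OF t_hom]]
        assms cofactor_mem_M)
  then obtain z where z: "\<And>x. q z x = \<phi> (poly_endo ?R t x)"
    by (rule unimodular_represents[OF unimodular]) blast
  have "q z x = 5 * \<phi> x" if "x \<in> M" for x
    using that by (simp add: z projection_M assms(2))
  moreover have "poly_endo C s z = 0"
  proof (rule unimodular_nondegenerate[OF unimodular])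
    fix y
    have "q (poly_endo C s z) y = q z (poly_endo C t y)"
      using adjoint[of C y z] by (simp add: sym)
    also have "\<dots> = \<phi> (poly_endo ((u * v) * (C * C')) t y)"
      by (simp add: z mult_ac flip: poly_endo_mult[OF t_hom])
    also have "\<dots> = \<phi> (0 *s 0)"
      by (simp add: poly_endo_mult[OF t_hom, of "u * v"] annihilated
          module_hom.zero[OF poly_endo_hom[OF t_hom]])
    also have "\<dots> = 0" using assms(2)[of 0 0] by simp
    finally show "q (poly_endo C s z) y = 0" .
  qed
  ultimately show thesis using that M_of_inverse by blast
qed

text \<open>
  By \<open>dual_represented\<close> this is 5 times the dual lattice of \<open>M\<close>.
\<close>

definition dual5 :: "'a set" where
  "dual5 = {z \<in> M. \<forall>x\<in>M. 5 dvd q z x}"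

text \<open>
  The coordinate functionals of a basis of \<open>M\<close> are represented in \<open>dual5\<close>, and \<open>w\<close> is divisible by 5 as
  soon as its coordinates are.
\<close>

lemma double_dual:
  assumes bs: "ordered_basis bs M" and w: "w \<in> M" "\<And>z. z \<in> dual5 \<Longrightarrow> 25 dvd q w z"
  shows "\<exists>m\<in>M. w = 5 *s m"
proof -
  have "5 dvd coord bs w i" for i
  proof -
    obtain z where z: "z \<in> M" "\<And>x. x \<in> M \<Longrightarrow> q z x = 5 * coord bs x i"
      by (rule dual_represented[of "\<lambda>x. coord bs x i"])
        (use coord_add[OF bs] coord_scale[OF bs] in auto)
    then have "25 dvd q z w" using w(2)[of z] by (auto simp: dual5_def sym)
    then have "5 * 5 dvd 5 * coord bs w i" using z(2)[OF w(1)] by simp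
    then show ?thesis by (simp only: dvd_mult_cancel_left) simp
  qed
  then have "w = 5 *s (\<Sum>i<length bs. (coord bs w i div 5) *s bs ! i)"
    using sum_coord[OF bs w(1)] by (simp add: scale_sum_right)
  then show ?thesis by (rule bexI[OF _ sum_basis_mem[OF bs]])
qed

lemma divisible_by_5:
  assumes "\<And>y. 5 dvd q x y"
  shows "\<exists>m. x = 5 *s m"
proof -
  have "module_hom scale (*) (\<lambda>y. q x y div 5)"
    by (intro functionalI) (use assms in \<open>auto simp: q_simps div_mult_swap elim!: dvdE\<close>)
  then obtain m where m: "\<And>y. q m y = q x y div 5"
    by (rule unimodular_represents[OF unimodular]) blast
  have "x - 5 *s m = 0"
    by (rule unimodular_nondegenerate[OF unimodular]) (use assms in \<open>simp add: q_simps m\<close>)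
  then show ?thesis by (auto intro: exI[of _ m])
qed

text \<open>
  The operator \<open>(C' u)(t)\<close> maps the whole lattice to \<open>M\<close>, so that its adjoint sends \<open>z\<close> to a vector whose
  products with all vectors are divisible by 5; such a vector is itself divisible by 5. On \<open>M\<close> this
  adjoint is \<open>\<Phi>\<^sub>1\<^sub>2\<close> of the inverse of \<open>t\<close>.
\<close>

lemma cyclotomic_12_dual5:
  assumes z: "z \<in> dual5"
  shows "\<exists>m\<in>M. poly_endo (cyclotomic 12) t z = 5 *s m"
proof -
  have zM: "z \<in> M" using z by (simp add: dual5_def)
  have "5 dvd q (poly_endo (cyclotomic 12) s z) y" for y
  proof -
    have "poly_endo (cyclotomic 12) s z = poly_endo (C' * u) s z"
      using poly_endo_cong_mod[OF s_hom cofactor M_inverse[OF zM]] by simp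
    then have "q (poly_endo (cyclotomic 12) s z) y = q z (poly_endo (C' * u) t y)"
      using adjoint[of "C' * u" y z] by (simp add: sym)
    then show ?thesis using z cofactor_mem_M[of u y] by (simp add: dual5_def)
  qed
  then obtain m where m: "poly_endo (cyclotomic 12) s z = 5 *s m" using divisible_by_5 by blast
  have "reflect_poly (cyclotomic 12) = cyclotomic 12" "degree (cyclotomic 12) = 4"
    unfolding cyclotomic_12 by (simp_all add: reflect_poly_def)
  then have eq: "poly_endo (cyclotomic 12) t z = 5 *s (t ^^ 4) m"
    using poly_endo_reflect[OF t_hom t_bij, of "cyclotomic 12" z]
    by (simp add: m module_hom.scale[OF module_hom_funpow[OF t_hom]])
  moreover have "(t ^^ 4) m \<in> M"
    using M_poly[OF zM, of "cyclotomic 12"] unfolding eq by (rule M_of_scale) simp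
  ultimately show ?thesis by blast
qed

text \<open>
  This is 5 times the overlattice \<open>{w \<in> M\<^sup>#. g(t) w \<in> M}\<close> of \<open>M\<close>, where \<open>g = x\<^sup>2 - 2 x - 1\<close> is one of
  the two factors of \<open>\<Phi>\<^sub>1\<^sub>2\<close> modulo 5.
\<close>

definition neighbour5 :: "'a set" where
  "neighbour5 = {w \<in> dual5. \<exists>m\<in>M. poly_endo [:-1, -2, 1:] t w = 5 *s m}"

text \<open>
  The overlattice is integral and even, since \<open>q(g(t) w, t w) = - 2 q(w, w)\<close> is divisible by 25.
\<close>

lemma neighbour5_norm:
  assumes w: "w \<in> neighbour5"
  shows "50 dvd q w w"
proof -
  have wM: "w \<in> M" and wd: "\<And>x. x \<in> M \<Longrightarrow> 5 dvd q w x"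
    using w by (auto simp: neighbour5_def dual5_def)
  obtain m where m: "m \<in> M" "poly_endo [:-1, -2, 1:] t w = 5 *s m"
    using w by (auto simp: neighbour5_def)
  have "5 dvd q w (s m)" using wd M_s[OF m(1)] by blast
  then have "5 dvd q m (t w)" by (simp add: sym[of m] q_t_left)
  then have "5 * 5 dvd q (5 *s m) (t w)" unfolding q_scale_left by (intro mult_dvd_mono) auto
  also have "q (5 *s m) (t w) = - 2 * q w w"
    unfolding m(2)[symmetric]
    by (simp add: poly_endo_pCons[OF t_hom] t_simps q_simps q_t sym[of w "t w"])
  finally have "25 dvd - 2 * q w w" by simp
  then have "25 dvd q w w" by presburger
  moreover have "2 dvd q w w" using even_norm by (simp add: even_lattice_def)
  ultimately show ?thesis by presburger
qed

lemma dual5_t: "z \<in> dual5 \<Longrightarrow> t z \<in> dual5"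
  by (auto simp: dual5_def q_t_left M_t M_s)

lemma dual5_s: "z \<in> dual5 \<Longrightarrow> s z \<in> dual5"
  by (auto simp: dual5_def q_s_left M_t M_s)

lemma dual5_add: "z \<in> dual5 \<Longrightarrow> z' \<in> dual5 \<Longrightarrow> z + z' \<in> dual5"
  and dual5_diff: "z \<in> dual5 \<Longrightarrow> z' \<in> dual5 \<Longrightarrow> z - z' \<in> dual5"
  and dual5_scale: "z \<in> dual5 \<Longrightarrow> a *s z \<in> dual5"
  by (auto simp: dual5_def q_simps M_add M_diff M_scale)

lemma dual5_poly:
  assumes "z \<in> dual5"
  shows "poly_endo p t z \<in> dual5"
proof (induction p)
  case 0
  show ?case by (simp add: dual5_def)
next
  case (pCons a p)
  then show ?case
    using assms by (simp add: poly_endo_pCons[OF t_hom] dual5_add dual5_scale dual5_t)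
qed

lemma five_mem_neighbour5: "m \<in> M \<Longrightarrow> 5 *s m \<in> neighbour5"
  by (auto simp: neighbour5_def dual5_def q_scale_left M_scale module_hom.scale[OF poly_endo_hom[OF t_hom]]
      intro!: bexI[of _ "poly_endo [:-1, -2, 1:] t m"] M_poly)

lemma neighbour5_diff: "w \<in> neighbour5 \<Longrightarrow> w' \<in> neighbour5 \<Longrightarrow> w - w' \<in> neighbour5"
  by (auto simp: neighbour5_def module_hom.diff[OF poly_endo_hom[OF t_hom]] dual5_diff
      simp flip: scale_right_diff_distrib simp del: poly_endo_pCons[OF t_hom] intro: M_diff)

lemma neighbour5_s: "w \<in> neighbour5 \<Longrightarrow> s w \<in> neighbour5"
proof -
  assume w: "w \<in> neighbour5"
  then obtain m where m: "m \<in> M" "poly_endo [:-1, -2, 1:] t w = 5 *s m"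
    by (auto simp: neighbour5_def)
  have "t (poly_endo [:-1, -2, 1:] t (s w)) = t (5 *s s m)"
    unfolding poly_endo_commute[OF t_hom, symmetric] t_s m(2) by (simp add: t_simps)
  then have "poly_endo [:-1, -2, 1:] t (s w) = 5 *s s m" by (simp only: t_eq_iff)
  moreover have "s m \<in> M" "s w \<in> dual5"
    using w m by (auto simp: neighbour5_def intro: M_s dual5_s)
  ultimately show ?thesis unfolding neighbour5_def by blast
qed

text \<open>
  Here \<open>f = x\<^sup>2 + 2 x - 1\<close> is the other factor: \<open>g f = \<Phi>\<^sub>1\<^sub>2 - 5 x\<^sup>2\<close>.
\<close>

lemma conjugate_factor_mem_neighbour5:
  assumes z: "z \<in> dual5"
  shows "poly_endo [:-1, 2, 1:] t z \<in> neighbour5"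
proof -
  have zM: "z \<in> M" using z by (simp add: dual5_def)
  obtain m where m: "m \<in> M" "poly_endo (cyclotomic 12) t z = 5 *s m"
    using cyclotomic_12_dual5[OF z] by blast
  have "[:-1, -2, 1:] * [:-1, 2, 1:] = cyclotomic 12 - [:0, 0, 5:]"
    unfolding cyclotomic_12 by simp
  then have "poly_endo [:-1, -2, 1:] t (poly_endo [:-1, 2, 1:] t z) =
      poly_endo (cyclotomic 12 - [:0, 0, 5:]) t z"
    by (simp only: poly_endo_mult[OF t_hom, symmetric])
  also have "\<dots> = 5 *s (m - t (t z))"
    by (simp add: poly_endo_diff[OF t_hom] m(2) poly_endo_pCons[OF t_hom] t_simps
        scale_right_diff_distrib)
  finally show ?thesis
    using dual5_poly[OF z] m(1) zM unfolding neighbour5_def by (auto intro: M_diff M_t)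
qed

text \<open>
  The overlattice is its own dual: the adjoint of \<open>g(t)\<close> is \<open>- t\<^sup>-\<^sup>2 f(t)\<close>, which maps the dual lattice into
  the overlattice. So \<open>g(t) z\<close> has integral products, after scaling, with the dual lattice of \<open>M\<close>.
\<close>

lemma neighbour5_self_dual:
  assumes bs: "ordered_basis bs M" and z: "z \<in> dual5"
    and dual: "\<And>w. w \<in> neighbour5 \<Longrightarrow> 25 dvd q z w"
  shows "z \<in> neighbour5"
proof -
  have "25 dvd q (poly_endo [:-1, -2, 1:] t z) z'" if z': "z' \<in> dual5" for z'
  proof -
    have "q (poly_endo [:-1, -2, 1:] t z) z' = q z (poly_endo [:-1, -2, 1:] s z')"
      by (rule adjoint)
    also have "poly_endo [:-1, -2, 1:] s z' = - s (s (poly_endo [:-1, 2, 1:] t z'))"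
      by (simp add: poly_endo_pCons[OF t_hom] poly_endo_pCons[OF s_hom] s_simps t_simps algebra_simps)
    also have "q z \<dots> = - q z (s (s (poly_endo [:-1, 2, 1:] t z')))"
      using q_diff_right[of z 0] by simp
    finally show ?thesis
      using dual[OF neighbour5_s[OF neighbour5_s[OF conjugate_factor_mem_neighbour5[OF z']]]] by simp
  qed
  moreover have "poly_endo [:-1, -2, 1:] t z \<in> M" using z by (intro M_poly) (simp add: dual5_def)
  ultimately show ?thesis using double_dual[OF bs] z by (auto simp: neighbour5_def)
qed

section \<open>The signature\<close>

text \<open>
  The overlattice \<open>neighbour5\<close>, divided by 5 and written in the coordinates \<open>q(w, b)\<close>, is the self-dual
  subgroup \<open>H\<close> required by the evaluation of the Gauss sum. A vector \<open>c\<close> annihilating \<open>H\<close> defines an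
  integral functional \<open>\<phi>\<close> on \<open>M\<close>; it is represented by an element of \<open>dual5\<close>, to which self-duality of the
  overlattice applies.
\<close>

lemma positive_gauss_product:
  assumes bs: "ordered_basis bs M" and B: "complete_orthogonal_set M B"
  shows "\<exists>N>0. (\<Prod>b\<in>B. \<Sum>x=0..<2 * \<bar>q b b div 2\<bar>.
      cis (pi * of_int x ^ 2 / (2 * of_int (q b b div 2)))) = of_nat N"
proof -
  have fin: "finite B" and BM: "B \<subseteq> M" and nz: "\<And>b. b \<in> B \<Longrightarrow> q b b \<noteq> 0"
    and orth: "\<And>b b'. b \<in> B \<Longrightarrow> b' \<in> B \<Longrightarrow> b \<noteq> b' \<Longrightarrow> q b b' = 0"
    using B by (auto simp: complete_orthogonal_set_def orthogonal_set_def)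
  have even_q: "2 dvd q x x" for x using even_norm by (simp add: even_lattice_def)
  then have half: "2 * (q b b div 2) = q b b" for b by simp
  define a where "a b = q b b div 2" for b
  have a: "q b b = 2 * a b" for b using half by (simp add: a_def)
  define H where "H = {c. \<exists>w\<in>neighbour5. \<forall>b\<in>B. 5 * c b = q w b}"
  have "\<exists>N>0. (\<Prod>b\<in>B. \<Sum>x=0..<2 * \<bar>a b\<bar>. cis (pi * of_int x ^ 2 / (2 * of_int (a b)))) = of_nat N"
  proof (rule gauss_sum_self_dual[where H = H])
    show "finite B" by (rule fin)
    show "a b \<noteq> 0" if "b \<in> B" for b using nz[OF that] by (simp add: a)
    show "(\<lambda>b. c b - d b) \<in> H" if cd: "c \<in> H" "d \<in> H" for c d
    proof -
      obtain w w' where "w \<in> neighbour5" "\<forall>b\<in>B. 5 * c b = q w b" "w' \<in> neighbour5" "\<forall>b\<in>B. 5 * d b = q w' b"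
        using cd by (auto simp: H_def)
      then show ?thesis unfolding H_def
        by (auto simp: q_diff_left right_diff_distrib intro!: bexI[of _ "w - w'"] neighbour5_diff)
    qed
    show "c \<in> H" if c: "\<And>b. b \<in> B \<Longrightarrow> 2 * a b dvd c b" for c
    proof -
      define m where "m = (\<Sum>b\<in>B. (c b div q b b) *s b)"
      have m: "m \<in> M" unfolding m_def using BM by (intro submodule_closed[OF bs]) auto
      have "q m b = c b" if b: "b \<in> B" for b
      proof -
        have "q m b = (\<Sum>b'\<in>B. if b' = b then c b div q b b * q b b else 0)"
          unfolding m_def q_sum_left q_scale_left using orth b by (intro sum.cong) auto
        then show ?thesis using c[OF b] fin b by (simp add: a)
      qed
      then show ?thesis unfolding H_def
        using five_mem_neighbour5[OF m] by (auto simp: q_scale_left intro!: bexI[of _ "5 *s m"])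
    qed
    show "(\<Sum>b\<in>B. of_int (h b) ^ 2 / (4 * of_int (a b)) :: real) \<in> \<int>" if h: "h \<in> H" for h
    proof -
      obtain w where w: "w \<in> neighbour5" "\<And>b. b \<in> B \<Longrightarrow> q w b = 5 * h b"
        using h by (force simp: H_def)
      then have wM: "w \<in> M" by (auto simp: neighbour5_def dual5_def)
      obtain k where k: "q w w = 50 * k" using neighbour5_norm[OF w(1)] by (elim dvdE)
      have "of_int (q w w) = (\<Sum>b\<in>B. of_int (q w b * q w b) / of_int (q b b) :: real)"
        by (rule parseval[OF bs B wM])
      also have "\<dots> = (\<Sum>b\<in>B. 50 * (of_int (h b) ^ 2 / (4 * of_int (a b))))"
        using w(2) by (intro sum.cong) (auto simp: a power2_eq_square field_simps)
      finally have "50 * (of_int k :: real) = 50 * (\<Sum>b\<in>B. of_int (h b) ^ 2 / (4 * of_int (a b)))"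
        by (simp only: k of_int_mult of_int_numeral sum_distrib_left)
      then have "(\<Sum>b\<in>B. of_int (h b) ^ 2 / (4 * of_int (a b))) = (of_int k :: real)"
        by linarith
      then show ?thesis by simp
    qed
    show "c \<in> H"
      if c: "\<And>h. h \<in> H \<Longrightarrow> (\<Sum>b\<in>B. of_int (c b * h b) / (2 * of_int (a b)) :: real) \<in> \<int>" for c
    proof -
      define \<Phi> where "\<Phi> x = (\<Sum>b\<in>B. of_int (c b * q x b) / of_int (q b b) :: real)" for x
      define \<phi> where "\<phi> x = \<lfloor>\<Phi> x\<rfloor>" for x
      have H_pairing: "(\<Sum>b\<in>B. of_int (c b * h b) / of_int (q b b) :: real) \<in> \<int>" if "h \<in> H" for h
        using c[OF that] by (simp add: a)
      have \<phi>: "of_int (\<phi> x) = \<Phi> x" if "x \<in> M" for x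
      proof -
        have "q x \<in> H" unfolding H_def
          using five_mem_neighbour5[OF that] by (auto simp: q_scale_left intro!: bexI[of _ "5 *s x"])
        then have "\<Phi> x \<in> \<int>" unfolding \<Phi>_def by (rule H_pairing)
        then show ?thesis by (simp add: \<phi>_def)
      qed
      have \<Phi>_add: "\<Phi> (x + y) = \<Phi> x + \<Phi> y" and \<Phi>_scale: "\<Phi> (k *s x) = of_int k * \<Phi> x" for x y k
        by (simp_all add: \<Phi>_def q_simps algebra_simps add_divide_distrib sum.distrib sum_distrib_left)
      obtain z where z: "z \<in> M" "\<And>x. x \<in> M \<Longrightarrow> q z x = 5 * \<phi> x"
      proof (rule dual_represented[of \<phi>])
        fix x y assume "x \<in> M" "y \<in> M"
        then have "real_of_int (\<phi> (x + y)) = of_int (\<phi> x + \<phi> y)" by (simp add: \<phi> M_add \<Phi>_add)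
        then show "\<phi> (x + y) = \<phi> x + \<phi> y" by (simp only: of_int_eq_iff)
      next
        fix k x assume "x \<in> M"
        then have "real_of_int (\<phi> (k *s x)) = of_int (k * \<phi> x)" by (simp add: \<phi> M_scale \<Phi>_scale)
        then show "\<phi> (k *s x) = k * \<phi> x" by (simp only: of_int_eq_iff)
      qed blast
      have zd: "z \<in> dual5" using z by (simp add: dual5_def)
      have zb: "q z b = 5 * c b" if b: "b \<in> B" for b
      proof -
        have "\<Phi> b = (\<Sum>b'\<in>B. if b' = b then of_int (c b) else 0)"
          unfolding \<Phi>_def using orth b nz by (intro sum.cong) auto
        then have "\<phi> b = c b" using fin b by (simp add: \<phi>_def)
        then show ?thesis using z(2) b BM by auto
      qed
      have "25 dvd q z w" if w: "w \<in> neighbour5" for w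
      proof -
        have wM: "w \<in> M" and "\<forall>x\<in>M. 5 dvd q w x" using w by (auto simp: neighbour5_def dual5_def)
        then have d: "5 dvd q w b" if "b \<in> B" for b using BM that by auto
        then have "(\<lambda>b. q w b div 5) \<in> H" using w by (auto simp: H_def)
        then have "(\<Sum>b\<in>B. of_int (c b * (q w b div 5)) / of_int (q b b) :: real) \<in> \<int>"
          by (rule H_pairing)
        then obtain k where k: "(\<Sum>b\<in>B. of_int (c b * (q w b div 5)) / of_int (q b b)) = (of_int k :: real)"
          by (elim Ints_cases)
        have "\<Phi> w = (\<Sum>b\<in>B. 5 * (of_int (c b * (q w b div 5)) / of_int (q b b)))"
          unfolding \<Phi>_def
        proof (rule sum.cong)
          fix b assume "b \<in> B"
          obtain j where "q w b = 5 * j" using d[OF \<open>b \<in> B\<close>] by (elim dvdE)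
          then show "of_int (c b * q w b) / of_int (q b b) =
              (5 * (of_int (c b * (q w b div 5)) / of_int (q b b)) :: real)" by simp
        qed simp
        also have "\<dots> = of_int (5 * k)"
          unfolding sum_distrib_left[symmetric] k by simp
        finally have "\<phi> w = 5 * k" by (simp only: \<phi>_def floor_of_int)
        then show ?thesis using z(2)[OF wM] by simp
      qed
      then have "z \<in> neighbour5" by (rule neighbour5_self_dual[OF bs zd])
      then show ?thesis using zb by (auto simp: H_def intro!: bexI[of _ z])
    qed
  qed
  then show ?thesis by (simp only: a_def)
qed

lemma signature_not_2_14: "\<not> has_signature M 2 14"
proof
  assume sig: "has_signature M 2 14"
  then obtain bs where bs: "ordered_basis bs M" by (auto simp: has_signature_def)
  obtain B where B: "complete_orthogonal_set M B"
    and pos: "card {b \<in> B. q b b > 0} = 2" and neg: "card {b \<in> B. q b b < 0} = 14"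
    by (rule complete_orthogonal_set_of_signature[OF sig M_nondegenerate]) auto
  have fin: "finite B" and nz: "\<And>b. b \<in> B \<Longrightarrow> q b b \<noteq> 0"
    using B by (auto simp: complete_orthogonal_set_def orthogonal_set_def)
  have even_q: "2 dvd q x x" for x using even_norm by (simp add: even_lattice_def)
  define a where "a b = q b b div 2" for b
  have a: "q b b = 2 * a b" for b using even_q[of b] by (simp add: a_def)
  define S where "S = (\<Prod>b\<in>B. sqrt (of_int \<bar>a b\<bar>))"
  have S: "S > 0" unfolding S_def using nz by (intro prod_pos) (auto simp: a)
  obtain N where N: "N > 0"
    "(\<Prod>b\<in>B. \<Sum>x=0..<2 * \<bar>a b\<bar>. cis (pi * of_int x ^ 2 / (2 * of_int (a b)))) = of_nat N"
    using positive_gauss_product[OF bs B, folded a_def] by blast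
  have "of_nat N = (\<Prod>b\<in>B. of_real (sqrt (of_int \<bar>a b\<bar>)) * (if a b > 0 then 1 + \<i> else 1 - \<i>))"
    unfolding N(2)[symmetric] using nz by (intro prod.cong signed_gauss_sum) (auto simp: a)
  also have "\<dots> = of_real S * (\<Prod>b\<in>B. if a b > 0 then 1 + \<i> else 1 - \<i>)"
    by (simp add: prod.distrib S_def)
  also have "(\<Prod>b\<in>B. if a b > 0 then 1 + \<i> else 1 - \<i>) = (1 + \<i>) ^ 2 * (1 - \<i>) ^ 14"
  proof -
    have "{b \<in> B. \<not> a b > 0} = {b \<in> B. q b b < 0}" using nz by (force simp: a)
    then have "card {b \<in> B. \<not> a b > 0} = 14" using neg by simp
    moreover have "card {b \<in> B. a b > 0} = 2" using pos by (simp add: a)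
    moreover have "B \<inter> {b. a b > 0} = {b \<in> B. a b > 0}" "B \<inter> - {b. a b > 0} = {b \<in> B. \<not> a b > 0}"
      by auto
    ultimately show ?thesis unfolding prod.If_cases[OF fin] by (simp only: prod_constant)
  qed
  also have "\<dots> = - 256"
    by (simp add: power_numeral_reduce algebra_simps complex_eq_iff)
  finally have "of_nat N = (of_real (- 256 * S) :: complex)" by simp
  then have "real N = - 256 * S" by (metis of_real_eq_iff of_real_of_nat_eq)
  then show False using S by simp
qed

end

theorem proposition12p2:
  fixes scale :: "int \<Rightarrow> 'a::ab_group_add \<Rightarrow> 'a"
    and q :: "'a \<Rightarrow> 'a \<Rightarrow> int"
  assumes "integral_lattice scale q"
    and "integral_lattice.even_lattice q"
    and "integral_lattice.unimodular scale q"
    and "integral_lattice.has_signature scale q UNIV 3 19"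
  shows "\<not> (\<exists>t. integral_lattice.isometry scale q t \<and>
              (\<exists>C'. product_of_cyclotomics C' \<and>
                    integral_lattice.has_char_poly scale t (cyclotomic 60 * C')) \<and>
              integral_lattice.has_signature scale q
                (integral_lattice.poly_kernel scale (cyclotomic 60) t) 2 14)"
proof (intro notI, elim exE conjE)
  interpret integral_lattice scale q by (rule assms)
  fix t C'
  assume t: "isometry t" and C': "product_of_cyclotomics C'"
    and char: "has_char_poly t (cyclotomic 60 * C')"
    and sig: "has_signature (poly_kernel (cyclotomic 60) t) 2 14"
  obtain bs where bs: "ordered_basis bs UNIV" and cp: "char_poly (endo_matrix bs t) = cyclotomic 60 * C'"
    using char by (auto simp: has_char_poly_def)
  have "length bs \<le> 3 + 19"
    by (rule complete_orthogonal_set_of_signature[OF assms(4)])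
      (use unimodular_nondegenerate[OF assms(3)] bs in auto)
  moreover have "endo_matrix bs t \<in> carrier_mat (length bs) (length bs)"
    by (simp add: endo_matrix_def)
  then have "degree (cyclotomic 60 * C') = length bs" "coeff (cyclotomic 60 * C') (length bs) = 1"
    using degree_monic_char_poly[of "endo_matrix bs t" "length bs"] by (simp_all add: cp)
  moreover have "cyclotomic 60 * C' \<noteq> 0"
    using \<open>coeff (cyclotomic 60 * C') (length bs) = 1\<close> by (metis coeff_0 zero_neq_one)
  moreover have "degree (cyclotomic 60) = 16" by (simp add: degree_cyclotomic totient_values)
  ultimately have "degree C' \<le> 6" by (auto simp: degree_mult_eq)
  then obtain u where u: "cyclotomic 60 dvd C' * u - cyclotomic 12"
    using cofactor_mod_cyclotomic_60[OF C'] by blast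
  obtain v where v: "cyclotomic 60 dvd cyclotomic 12 * v - [:5:]"
    using five_mod_cyclotomic_60 by blast
  have hom: "module_hom scale scale t" using t by (simp add: isometry_def)
  interpret cyclotomic_60_isometry scale q t C' u v
    by unfold_locales
      (use assms t u v cayley_hamilton[OF hom bs] in \<open>auto simp: cp\<close>)
  show False using signature_not_2_14 sig by blast
qed

end
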